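(* Let $d\ge1$ and let $(\mathbb Z^d,E,\mu,w)$ be the weighted nearest-neighbour lattice graph with vertex measure $\mu(x)=\sum_{y\sim x}w_{xy}$, satisfying $0<\mu_{\min}\le\mu_{\max}<\infty$ and $\inf_{x\sim y}w_{xy}>0$, with normalized Laplacian $\Delta$. Let $u\in C_c(\mathbb Z^d)$. Then for every $1<p\le\infty$, $$\log(-\Delta)u\in\ell^p(\mathbb Z^d),$$ and $$\frac{(-\Delta)^su-u}{s}\longrightarrow\log(-\Delta)u\quad\text{strongly in }\ell^p(\mathbb Z^d)\text{ as }s\to0^+ .$$
   Context: Weighted lattice graph: vertex set $\mathbb Z^d$, with $x\sim y$ iff $|x-y|_1=1$; symmetric weights $w_{xy}=w_{yx}>0$ if $x\sim y$ and $w_{xy}=0$ otherwise (in particular $w_{xx}=0$); $\mu(x)=\sum_{y\sim x}w_{xy}$; $\mu_{\min}=\inf_x\mu(x)$, $\mu_{\max}=\sup_x\mu(x)$. $C_c(\mathbb Z^d)$ is the space of finitely supported real functions; $\|u\|_{\ell^p}^p=\sum_x|u(x)|^p\mu(x)$ for $p<\infty$ and $\|u\|_{\ell^\infty}=\sup_x|u(x)|$. The normalized Laplacian is $\Delta u(x)=\frac1{\mu(x)}\sum_{y\sim x}w_{xy}(u(y)-u(x))$, a bounded self-adjoint operator on $\ell^2(\mathbb Z^d,\mu)$. The heat kernel $p(t,x,y)$, $t\ge0$, is defined by $e^{t\Delta}u(x)=\sum_{y}p(t,x,y)u(y)\mu(y)$, i.e. $p(t,x,y)=\mu(y)^{-1}(e^{t\Delta}\mathbf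 1_{\{y\}})(x)$. For $0<s<1$ the fractional Laplacian is $$(-\Delta)^su(x)=\frac1{\mu(x)}\sum_{y\ne x}W_s(x,y)\bigl(u(x)-u(y)\bigr),\qquad W_s(x,y)=\frac{s}{\Gamma(1-s)}\mu(x)\mu(y)\int_0^\infty p(t,x,y)\,t^{-1-s}\,dt .$$ The logarithmic Laplacian of $u\in C_c(\mathbb Z^d)$ is given by $$(\log(-\Delta)u)(x)=\int_0^\infty\frac{e^{-t}u(x)-(e^{t\Delta}u)(x)}{t}\,dt,\qquad x\in\mathbb Z^d ,$$ which agrees with the functional-calculus definition $\int_{(0,\infty)}\log\lambda\,dE(\lambda)u$, $E$ being the spectral measure of $-\Delta$ on $\ell^2(\mathbb Z^d,\mu)$. *)

theory Defs
  imports "HOL-Analysis.Analysis"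
begin

definition adj :: "int ^ 'd \<Rightarrow> int ^ 'd \<Rightarrow> bool" (infix "\<sim>\<^sub>\<int>" 50)
  where "x \<sim>\<^sub>\<int> y \<longleftrightarrow> (\<Sum>i\<in>UNIV. \<bar>x $ i - y $ i\<bar>) = 1"

lemma finite_adj: "finite {y :: int ^ 'd. x \<sim>\<^sub>\<int> y}"
proof (rule finite_subset)
  show "{y. x \<sim>\<^sub>\<int> y} \<subseteq> vec_lambda ` (PiE UNIV (\<lambda>i. {x $ i - 1 .. x $ i + 1}))"
  proof
    fix y assume "y \<in> {y. x \<sim>\<^sub>\<int> y}"
    then have s: "(\<Sum>i\<in>UNIV. \<bar>x $ i - y $ i\<bar>) = 1" by (simp add: adj_def)
    have "\<bar>x $ i - y $ i\<bar> \<le> 1" for i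
      unfolding s[symmetric] by (rule member_le_sum) auto
    then have "vec_nth y \<in> PiE UNIV (\<lambda>i. {x $ i - 1 .. x $ i + 1})"
      by (auto simp: abs_le_iff algebra_simps)
    then show "y \<in> vec_lambda ` (PiE UNIV (\<lambda>i. {x $ i - 1 .. x $ i + 1}))"
      by (metis image_eqI vec_nth_inverse)
  qed
  show "finite (vec_lambda ` (PiE UNIV (\<lambda>i. {x $ i - 1 .. x $ i + 1})))"
    by (intro finite_imageI finite_PiE) auto
qed

definition lattice_weight :: "(int ^ 'd \<Rightarrow> int ^ 'd \<Rightarrow> real) \<Rightarrow> bool"
  where "lattice_weight w \<longleftrightarrow>
    (\<forall>x y. w x y = w y x) \<and>
    (\<forall>x y. x \<sim>\<^sub>\<int> y \<longrightarrow> 0 < w x y) \<and>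
    (\<forall>x y. \<not> x \<sim>\<^sub>\<int> y \<longrightarrow> w x y = 0)"

definition vmeas :: "(int ^ 'd \<Rightarrow> int ^ 'd \<Rightarrow> real) \<Rightarrow> int ^ 'd \<Rightarrow> real"
  where "vmeas w x = (\<Sum>y | x \<sim>\<^sub>\<int> y. w x y)"

text \<open>Extrema are taken in the extended reals, where they need no boundedness assumption.\<close>

definition vmeas_min :: "(int ^ 'd \<Rightarrow> int ^ 'd \<Rightarrow> real) \<Rightarrow> ereal"
  where "vmeas_min w = (INF x. ereal (vmeas w x))"

definition vmeas_max :: "(int ^ 'd \<Rightarrow> int ^ 'd \<Rightarrow> real) \<Rightarrow> ereal"
  where "vmeas_max w = (SUP x. ereal (vmeas w x))"

definition weight_inf :: "(int ^ 'd \<Rightarrow> int ^ 'd \<Rightarrow> real) \<Rightarrow> ereal"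
  where "weight_inf w = (INF (x, y) \<in> {(x, y). x \<sim>\<^sub>\<int> y}. ereal (w x y))"

definition Cc :: "(int ^ 'd \<Rightarrow> real) set"
  where "Cc = {u. finite {x. u x \<noteq> 0}}"

definition lp_space :: "(int ^ 'd \<Rightarrow> int ^ 'd \<Rightarrow> real) \<Rightarrow> ereal \<Rightarrow> (int ^ 'd \<Rightarrow> real) set"
  where "lp_space w p =
    (if p = \<infinity> then {u. bounded (range u)}
     else {u. (\<lambda>x. \<bar>u x\<bar> powr real_of_ereal p * vmeas w x) summable_on UNIV})"

text \<open>Only meaningful for elements of \<open>lp_space w p\<close>: elsewhere the sum or supremum has a
  default value.\<close>

definition lp_norm :: "(int ^ 'd \<Rightarrow> int ^ 'd \<Rightarrow> real) \<Rightarrow> ereal \<Rightarrow> (int ^ 'd \<Rightarrow> real) \<Rightarrow> real"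
  where "lp_norm w p u =
    (if p = \<infinity> then (SUP x. \<bar>u x\<bar>)
     else (\<Sum>\<^sub>\<infinity>x. \<bar>u x\<bar> powr real_of_ereal p * vmeas w x) powr (1 / real_of_ereal p))"

definition lp_tendsto ::
    "(int ^ 'd \<Rightarrow> int ^ 'd \<Rightarrow> real) \<Rightarrow> ereal \<Rightarrow> ('s \<Rightarrow> int ^ 'd \<Rightarrow> real) \<Rightarrow> (int ^ 'd \<Rightarrow> real)
      \<Rightarrow> 's filter \<Rightarrow> bool"
  where "lp_tendsto w p f g F \<longleftrightarrow>
    g \<in> lp_space w p \<and> (\<forall>\<^sub>F s in F. f s \<in> lp_space w p) \<and>
    ((\<lambda>s. lp_norm w p (\<lambda>x. f s x - g x)) \<longlongrightarrow> 0) F"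

definition laplacian ::
    "(int ^ 'd \<Rightarrow> int ^ 'd \<Rightarrow> real) \<Rightarrow> (int ^ 'd \<Rightarrow> real) \<Rightarrow> int ^ 'd \<Rightarrow> real"
  where "laplacian w u x = 1 / vmeas w x * (\<Sum>y | x \<sim>\<^sub>\<int> y. w x y * (u y - u x))"

text \<open>The exponential series of the bounded operator \<open>t\<Delta>\<close>. On \<open>\<ell>\<^sup>2(\<mu>)\<close> it converges in operator
  norm; since point evaluations are continuous there, the value at \<open>x\<close> of the limit is the sum of
  the pointwise series below.\<close>

definition heat_semigroup ::
    "(int ^ 'd \<Rightarrow> int ^ 'd \<Rightarrow> real) \<Rightarrow> real \<Rightarrow> (int ^ 'd \<Rightarrow> real) \<Rightarrow> int ^ 'd \<Rightarrow> real"
  where "heat_semigroup w t u x = (\<Sum>n. t ^ n / fact n * (laplacian w ^^ n) u x)"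

definition heat_kernel ::
    "(int ^ 'd \<Rightarrow> int ^ 'd \<Rightarrow> real) \<Rightarrow> real \<Rightarrow> int ^ 'd \<Rightarrow> int ^ 'd \<Rightarrow> real"
  where "heat_kernel w t x y = 1 / vmeas w y * heat_semigroup w t (indicator {y}) x"

definition frac_weight ::
    "(int ^ 'd \<Rightarrow> int ^ 'd \<Rightarrow> real) \<Rightarrow> real \<Rightarrow> int ^ 'd \<Rightarrow> int ^ 'd \<Rightarrow> real"
  where "frac_weight w s x y =
    s / Gamma (1 - s) * vmeas w x * vmeas w y *
      (LBINT t:{0<..}. heat_kernel w t x y * t powr (- 1 - s))"

text \<open>\<open>(-\<Delta>)\<^sup>s\<close>, for \<open>0 < s < 1\<close>.\<close>

definition frac_laplacian ::
    "(int ^ 'd \<Rightarrow> int ^ 'd \<Rightarrow> real) \<Rightarrow> real \<Rightarrow> (int ^ 'd \<Rightarrow> real) \<Rightarrow> int ^ 'd \<Rightarrow> real"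
  where "frac_laplacian w s u x =
    1 / vmeas w x * (\<Sum>\<^sub>\<infinity>y\<in>{y. y \<noteq> x}. frac_weight w s x y * (u x - u y))"

text \<open>\<open>log(-\<Delta>)\<close>, for finitely supported \<open>u\<close>.\<close>

definition log_laplacian ::
    "(int ^ 'd \<Rightarrow> int ^ 'd \<Rightarrow> real) \<Rightarrow> (int ^ 'd \<Rightarrow> real) \<Rightarrow> int ^ 'd \<Rightarrow> real"
  where "log_laplacian w u x =
    (LBINT t:{0<..}. (exp (- t) * u x - heat_semigroup w t u x) / t)"

end

theory Submission
  imports Defs
begin

text \<open>
  Let \<open>P = 1 + \<Delta>\<close> be the transition operator of the random walk with conductances \<open>w\<close>. Functional
  calculus suggests the power series

    \<open>log (- \<Delta>) u = log (1 - P) u = - (\<Sum>n\<ge>0. P\<^sup>n\<^sup>+\<^sup>1 u / (n + 1))\<close>,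

    \<open>((- \<Delta>)\<^sup>s u - u) / s = ((1 - P)\<^sup>s u - u) / s = - (\<Sum>n\<ge>0. coef s n * P\<^sup>n\<^sup>+\<^sup>1 u)\<close>,

  where \<open>coef s n = (1 - s) (1 - s / 2) \<dots> (1 - s / n) / (n + 1)\<close>. These coefficients lie between 0
  and \<open>1 / (n + 1)\<close> and tend to \<open>1 / (n + 1)\<close> as \<open>s\<close> tends to 0. So the theorem follows by dominated
  convergence for series, with Minkowski's inequality in \<open>\<ell>\<^sup>p\<close>, as soon as the numbers
  \<open>\<parallel>P\<^sup>n u\<parallel>\<^sub>p / n\<close> are summable. Two things remain.

  The series have to be derived from the definitions by the heat semigroup. It is a Poisson mixture,
  \<open>exp (t \<Delta>) = exp (- t) (\<Sum>n. t\<^sup>n P\<^sup>n / n!)\<close> (\<open>heat_semigroup_eq\<close>), and integrating against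
  \<open>t\<^sup>-\<^sup>1\<^sup>-\<^sup>s\<close> term by term gives Gamma values (\<open>Gamma_series_integral\<close>). For the fractional Laplacian,
  sums over target vertices and over step numbers are interchanged, and
  \<open>s * (\<Sum>n. coef s n) = 1\<close> (\<open>coef_sums\<close>) takes care of the diagonal (\<open>frac_laplacian_eq\<close>).

  The norms of \<open>P\<^sup>n u\<close> have to decay. A polynomial rate is enough, and a one-dimensional argument
  gives \<open>n\<^sup>-\<^sup>1\<^sup>/\<^sup>4\<close> for the supremum in every dimension. The energies \<open>\<parallel>P\<^sup>n u\<parallel>\<^sub>2\<^sup>2\<close> form a convex
  decreasing sequence, so the energy lost in step \<open>n\<close> is at most of order \<open>1 / n\<close>. This loss is the sum of
  the one-step variances of \<open>P\<^sup>n u\<close>, which control the differences of its values at \<open>x + e\<^sub>i\<close> and \<open>x - e\<^sub>i\<close>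
  (\<open>variance_lower_bound\<close>); summing these along a ray bounds the supremum (\<open>pow4_le_energy\<close>).
  Interpolation with the contraction in \<open>\<ell>\<^sup>1\<close> gives decay in \<open>\<ell>\<^sup>p\<close> for every \<open>p > 1\<close>; for \<open>p = 1\<close> no
  decay is left.
\<close>

section \<open>Sums over countable sets and finitely supported functions\<close>

lemma has_sum_finite_sum:
  fixes f :: "'b \<Rightarrow> 'a \<Rightarrow> 'c :: topological_comm_monoid_add"
  assumes "\<And>i. i \<in> I \<Longrightarrow> (f i has_sum S i) A"
  shows "((\<lambda>x. \<Sum>i\<in>I. f i x) has_sum (\<Sum>i\<in>I. S i)) A"
  using assms
proof (induction I rule: infinite_finite_induct)
  case (insert i I)
  then show ?case by (simp add: has_sum_add)
qed simp_all

lemma has_sum_diff_real: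
  fixes f g :: "'a \<Rightarrow> real"
  assumes "(f has_sum a) A" "(g has_sum b) A"
  shows "((\<lambda>x. f x - g x) has_sum a - b) A"
  using has_sum_add[OF assms(1) has_sum_uminusI[OF assms(2)]] by simp

lemma summable_on_diff_real:
  fixes f g :: "'a \<Rightarrow> real"
  assumes "f summable_on A" "g summable_on A"
  shows "(\<lambda>x. f x - g x) summable_on A"
  using assms has_sum_diff_real unfolding summable_on_def by blast

lemma infsum_diff_real:
  fixes f g :: "'a \<Rightarrow> real"
  assumes "f summable_on A" "g summable_on A"
  shows "(\<Sum>\<^sub>\<infinity>x\<in>A. f x - g x) = infsum f A - infsum g A"
  using assms by (intro infsumI has_sum_diff_real has_sum_infsum)

lemma summable_on_finite_support:
  fixes f :: "'a \<Rightarrow> real"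
  assumes "finite {x. f x \<noteq> 0}"
  shows "f summable_on UNIV"
  using summable_on_finite[OF assms, of f]
  by (subst summable_on_cong_neutral[where T = "{x. f x \<noteq> 0}" and g = f]) auto

lemma infsum_finite_support:
  fixes f :: "'a \<Rightarrow> real"
  assumes "finite A" "\<And>x. x \<notin> A \<Longrightarrow> f x = 0"
  shows "infsum f UNIV = sum f A"
  using assms by (subst infsum_cong_neutral[where T = A and g = f]) auto

lemma Cc_I: "finite A \<Longrightarrow> (\<And>x. x \<notin> A \<Longrightarrow> f x = 0) \<Longrightarrow> f \<in> Cc"
  unfolding Cc_def by (auto intro: finite_subset)

lemma Cc_vanish: "f \<in> Cc \<Longrightarrow> (\<And>x. f x = 0 \<Longrightarrow> g x = 0) \<Longrightarrow> g \<in> Cc"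
  by (rule Cc_I[of "{x. f x \<noteq> 0}"]) (auto simp: Cc_def)

lemma summable_on_Cc: "f \<in> Cc \<Longrightarrow> f summable_on UNIV"
  by (simp add: Cc_def summable_on_finite_support)

lemma Cc_bounded:
  assumes "u \<in> Cc"
  obtains B where "\<And>x. \<bar>u x\<bar> \<le> B"
proof -
  have "\<bar>u x\<bar> \<le> (\<Sum>y | u y \<noteq> 0. \<bar>u y\<bar>)" for x
  proof (cases "u x = 0")
    case False
    then show ?thesis
      using assms by (intro member_le_sum[of x]) (auto simp: Cc_def)
  qed (simp add: sum_nonneg)
  then show thesis by (rule that)
qed

lemma indicator_Cc: "indicator {y} \<in> Cc"
  by (rule Cc_I[of "{y}"]) auto

section \<open>Convexity inequalities\<close>

text \<open>The decrements \<open>a k - a (k + 1)\<close> decrease and their total is at most \<open>a 0\<close>, so \<open>k + 1\<close> times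
  the last of the first \<open>k + 1\<close> is at most \<open>a 0\<close>.\<close>

lemma convex_seq_decrement_le:
  fixes a :: "nat \<Rightarrow> real"
  assumes nonneg: "\<And>k. 0 \<le> a k"
    and convex: "\<And>k. 2 * a (Suc k) \<le> a k + a (Suc (Suc k))"
  shows "a k - a (Suc k) \<le> a 0 / real (Suc k)"
proof -
  have "antimono (\<lambda>k. a k - a (Suc k))"
    using convex by (simp add: antimono_iff_le_Suc algebra_simps)
  then have "(\<Sum>j<Suc k. a k - a (Suc k)) \<le> (\<Sum>j<Suc k. a j - a (Suc j))"
    by (intro sum_mono) (simp only: antimono_def lessThan_iff less_Suc_eq_le)
  also have "\<dots> = a 0 - a (Suc k)"
    by (rule sum_lessThan_telescope')
  also have "\<dots> \<le> a 0"
    using nonneg[of "Suc k"] by simp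
  finally show ?thesis
    by (simp add: field_simps)
qed

text \<open>Convexity of \<open>y powr r\<close>, with the endpoint \<open>y = 0\<close> included.\<close>

lemma powr_above_tangent:
  fixes y z r :: real
  assumes r: "1 \<le> r" and y: "0 \<le> y" and z: "0 < z"
  shows "z powr r + r * z powr (r - 1) * (y - z) \<le> y powr r"
proof (cases "y = 0")
  case True
  have "z powr (r - 1) * z = z powr r"
    using z powr_mult_base[of z "r - 1"] by (simp add: mult.commute)
  then have "z powr r + r * z powr (r - 1) * (y - z) = (1 - r) * z powr r"
    using True by (simp add: algebra_simps)
  also have "\<dots> \<le> 0"
    using r by (simp add: mult_nonpos_nonneg)
  finally show ?thesis by (simp add: True)
next
  case False
  then have y: "0 < y" using y by simp
  have "r * z powr (r - 1) * (y - z) \<le> y powr r - z powr r"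
    using y z r
    by (intro convex_on_imp_above_tangent[where A = "{0<..}"] powr_convex)
      (auto intro!: derivative_eq_intros simp: interior_open)
  then show ?thesis by simp
qed

text \<open>Jensen's inequality for a sub-probability vector, by summing the tangent inequality at the mean.\<close>

lemma powr_convex_combination_le:
  fixes q y :: "'a \<Rightarrow> real"
  assumes r: "1 \<le> r" and q: "\<And>n. n \<in> N \<Longrightarrow> 0 \<le> q n" "sum q N \<le> 1"
    and y: "\<And>n. n \<in> N \<Longrightarrow> 0 \<le> y n"
  shows "(\<Sum>n\<in>N. q n * y n) powr r \<le> (\<Sum>n\<in>N. q n * y n powr r)"
proof -
  define z where "z = (\<Sum>n\<in>N. q n * y n)"
  have "0 \<le> z"
    unfolding z_def using q y by (intro sum_nonneg mult_nonneg_nonneg) auto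
  show ?thesis
  proof (cases "z = 0")
    case True
    then show ?thesis
      unfolding z_def[symmetric] using q by (auto intro!: sum_nonneg)
  next
    case False
    then have z: "0 < z" using \<open>0 \<le> z\<close> by simp
    have zz: "z powr (r - 1) * z = z powr r"
      using z powr_mult_base[of z "r - 1"] by (simp add: mult.commute)
    \<comment> \<open>When the weights sum to less than 1, the defect \<open>1 - sum q N\<close> only helps.\<close>
    have "z powr r \<le> z powr r * (1 + (r - 1) * (1 - sum q N))"
      using r q mult_left_mono[of 1 "1 + (r - 1) * (1 - sum q N)" "z powr r"] by simp
    also have "\<dots> = sum q N * z powr r + r * z powr r - r * z powr r * sum q N"
      by (simp add: algebra_simps)
    also have "\<dots> = sum q N * z powr r + r * z powr (r - 1) * (z - z * sum q N)"
      by (simp add: right_diff_distrib flip: zz)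
    also have "\<dots> = (\<Sum>n\<in>N. q n * (z powr r + r * z powr (r - 1) * (y n - z)))"
      by (subst (3) z_def) (simp add: algebra_simps sum.distrib sum_subtractf sum_distrib_left sum_distrib_right)
    also have "\<dots> \<le> (\<Sum>n\<in>N. q n * y n powr r)"
      using q y r z by (intro sum_mono mult_left_mono powr_above_tangent) auto
    finally show ?thesis by (simp add: z_def)
  qed
qed

text \<open>Minkowski's inequality in \<open>\<ell>\<^sup>r\<close>, reduced to Jensen's inequality by normalising the summands.\<close>

lemma minkowski_finite_sum:
  fixes f :: "'b \<Rightarrow> 'a \<Rightarrow> real" and m c :: "'b \<Rightarrow> real" and \<nu> :: "'a \<Rightarrow> real"
  assumes r: "1 \<le> r" and fin: "finite N" and \<nu>: "\<And>x. x \<in> X \<Longrightarrow> 0 \<le> \<nu> x"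
    and m: "\<And>n. n \<in> N \<Longrightarrow> 0 < m n" and c: "\<And>n. n \<in> N \<Longrightarrow> 0 \<le> c n"
    and f: "\<And>n. n \<in> N \<Longrightarrow> (\<Sum>x\<in>X. \<nu> x * \<bar>f n x\<bar> powr r) \<le> m n powr r"
  shows "(\<Sum>x\<in>X. \<nu> x * \<bar>\<Sum>n\<in>N. c n * f n x\<bar> powr r) \<le> (\<Sum>n\<in>N. c n * m n) powr r"
proof -
  define M where "M = (\<Sum>n\<in>N. c n * m n)"
  have cm: "0 \<le> c n * m n" if "n \<in> N" for n
    using c m that by (simp add: less_imp_le)
  then have "0 \<le> M"
    unfolding M_def by (rule sum_nonneg)
  show ?thesis
  proof (cases "M = 0")
    case True
    then have "c n = 0" if "n \<in> N" for n
      using sum_nonneg_eq_0_iff[OF fin, of "\<lambda>n. c n * m n"] cm m that unfolding M_def by force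
    then show ?thesis by simp
  next
    case False
    then have M: "0 < M" using \<open>0 \<le> M\<close> by simp
    \<comment> \<open>After normalising each \<open>f n\<close> by \<open>m n\<close>, the sum is \<open>M\<close> times a convex combination.\<close>
    define q where "q n = c n * m n / M" for n
    have q_nonneg: "0 \<le> q n" if "n \<in> N" for n
      using cm[OF that] M by (simp add: q_def)
    have q_sum: "sum q N = 1"
      using M by (simp add: q_def M_def flip: sum_divide_distrib)
    have pt: "\<bar>\<Sum>n\<in>N. c n * f n x\<bar> powr r
        \<le> M powr r * (\<Sum>n\<in>N. q n * (\<bar>f n x\<bar> powr r / m n powr r))" for x
    proof -
      have "\<bar>\<Sum>n\<in>N. c n * f n x\<bar> \<le> (\<Sum>n\<in>N. c n * \<bar>f n x\<bar>)"
        using sum_abs[of "\<lambda>n. c n * f n x" N] c by (simp add: abs_mult)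
      also have "\<dots> = (\<Sum>n\<in>N. M * (q n * (\<bar>f n x\<bar> / m n)))"
      proof (rule sum.cong)
        fix n assume "n \<in> N"
        then show "c n * \<bar>f n x\<bar> = M * (q n * (\<bar>f n x\<bar> / m n))"
          using M m[of n] by (simp add: q_def)
      qed simp
      finally have "\<bar>\<Sum>n\<in>N. c n * f n x\<bar> powr r \<le> (M * (\<Sum>n\<in>N. q n * (\<bar>f n x\<bar> / m n))) powr r"
        using r by (intro powr_mono2) (auto simp: sum_distrib_left)
      also have "\<dots> = M powr r * (\<Sum>n\<in>N. q n * (\<bar>f n x\<bar> / m n)) powr r"
        by (rule powr_mult)
      also have "\<dots> \<le> M powr r * (\<Sum>n\<in>N. q n * (\<bar>f n x\<bar> / m n) powr r)"
        using r q_nonneg q_sum m by (intro mult_left_mono powr_convex_combination_le) (auto simp: less_imp_le)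
      also have "(\<Sum>n\<in>N. q n * (\<bar>f n x\<bar> / m n) powr r) = (\<Sum>n\<in>N. q n * (\<bar>f n x\<bar> powr r / m n powr r))"
        using m by (intro sum.cong) (auto simp: powr_divide less_imp_le)
      finally show ?thesis .
    qed
    have "(\<Sum>x\<in>X. \<nu> x * \<bar>\<Sum>n\<in>N. c n * f n x\<bar> powr r)
        \<le> (\<Sum>x\<in>X. \<nu> x * (M powr r * (\<Sum>n\<in>N. q n * (\<bar>f n x\<bar> powr r / m n powr r))))"
      by (intro sum_mono mult_left_mono pt \<nu>)
    also have "\<dots> = M powr r * (\<Sum>n\<in>N. q n * ((\<Sum>x\<in>X. \<nu> x * \<bar>f n x\<bar> powr r) / m n powr r))"
      by (simp add: sum_distrib_left sum_distrib_right sum_divide_distrib sum.swap[of _ N] mult_ac)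
    also have "\<dots> \<le> M powr r * (\<Sum>n\<in>N. q n * 1)"
    proof (intro mult_left_mono sum_mono)
      fix n assume n: "n \<in> N"
      show "(\<Sum>x\<in>X. \<nu> x * \<bar>f n x\<bar> powr r) / m n powr r \<le> 1"
        using f[OF n] m[OF n] by (simp add: divide_le_eq_1)
    qed (use q_nonneg in auto)
    also have "\<dots> = M powr r" by (simp add: q_sum)
    finally show ?thesis by (simp add: M_def)
  qed
qed

section \<open>Binomial coefficients and Gamma integrals\<close>

text \<open>The coefficients of \<open>(1 - (1 - z)\<^sup>s) / s = (\<Sum>n. coef s n * z\<^sup>n\<^sup>+\<^sup>1)\<close>; for \<open>s = 0\<close> those of
  \<open>- log (1 - z)\<close>.\<close>

definition coef :: "real \<Rightarrow> nat \<Rightarrow> real"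
  where "coef s n = (\<Prod>k=1..n. 1 - s / real k) / real (Suc n)"

lemma coef_zero: "coef 0 n = 1 / real (Suc n)"
  by (simp add: coef_def)

lemma coef_nonneg: "0 \<le> s \<Longrightarrow> s < 1 \<Longrightarrow> 0 \<le> coef s n"
  unfolding coef_def by (intro divide_nonneg_nonneg prod_nonneg) (auto simp: field_simps)

lemma coef_le: "0 \<le> s \<Longrightarrow> s < 1 \<Longrightarrow> coef s n \<le> 1 / real (Suc n)"
  unfolding coef_def by (intro divide_right_mono prod_le_1) (auto simp: field_simps)

lemma coef_tendsto: "((\<lambda>s. coef s n) \<longlongrightarrow> coef 0 n) (at_right 0)"
  unfolding coef_def by (intro tendsto_intros) auto

lemma coef_Gamma:
  assumes "0 \<le> s" "s < 1"
  shows "Gamma (real (Suc n) - s) / fact (Suc n) = Gamma (1 - s) * coef s n"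
proof -
  have "Gamma (real (Suc n) - s) = Gamma (1 - s) * (\<Prod>k=1..n. 1 - s / real k) * fact n"
  proof (induction n)
    case (Suc n)
    have "Gamma (real (Suc (Suc n)) - s) = Gamma ((real (Suc n) - s) + 1)"
      by (simp add: algebra_simps)
    also have "\<dots> = (real (Suc n) - s) * Gamma (real (Suc n) - s)"
      using assms by (intro Gamma_plus1) (auto simp: nonpos_Ints_def)
    also have "\<dots> = Gamma (1 - s) * (\<Prod>k=1..n. 1 - s / real k) * ((1 - s / real (Suc n)) * real (Suc n)) * fact n"
      unfolding Suc by (simp add: field_simps)
    also have "\<dots> = Gamma (1 - s) * (\<Prod>k=1..Suc n. 1 - s / real k) * fact (Suc n)"
      by (simp add: prod.nat_ivl_Suc' mult_ac del: of_nat_Suc)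
    finally show ?case .
  qed simp
  then show ?thesis
    by (simp add: coef_def)
qed

text \<open>The value at \<open>z = 1\<close> of the series for \<open>(1 - (1 - z)\<^sup>s) / s\<close>. The remainder is the product of
  the \<open>1 - s / k\<close>, which tends to 0 by the divergence of the harmonic series.\<close>

lemma coef_sums:
  assumes s: "0 < s" "s < 1"
  shows "coef s sums (1 / s)"
proof -
  define p where "p n = (\<Prod>k=1..n. 1 - s / real k)" for n
  have p_nonneg: "0 \<le> p n" for n
    unfolding p_def using s by (intro prod_nonneg) (auto simp: field_simps)
  \<comment> \<open>The series telescopes.\<close>
  have part: "s * (\<Sum>n<N. coef s n) = 1 - p N" for N
  proof (induction N)
    case (Suc N)
    have "p (Suc N) = (1 - s / real (Suc N)) * p N"
      by (simp add: p_def prod.nat_ivl_Suc' mult_ac del: of_nat_Suc)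
    moreover have "coef s N = p N / real (Suc N)"
      by (simp add: coef_def p_def)
    ultimately show ?case
      using Suc by (simp add: algebra_simps diff_divide_distrib add_divide_distrib del: of_nat_Suc)
  qed (simp add: p_def)
  have p_le: "p n \<le> exp (- s * harm n)" for n
  proof -
    have "p n \<le> (\<Prod>k=1..n. exp (- s / real k))"
      unfolding p_def
    proof (intro prod_mono conjI)
      fix k assume "k \<in> {1..n}"
      then show "0 \<le> 1 - s / real k"
        using s by (simp add: field_simps)
      show "1 - s / real k \<le> exp (- s / real k)"
        using exp_ge_add_one_self[of "- s / real k"] by simp
    qed
    also have "\<dots> = exp (- s * harm n)"
      by (simp add: harm_def sum_distrib_left divide_inverse flip: exp_sum sum_negf)
    finally show ?thesis .
  qed
  have "(\<lambda>n. exp (- s * harm n)) \<longlonglongrightarrow> 0"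
  proof -
    have "filterlim (\<lambda>n. s * harm n :: real) at_top sequentially"
      using s by (intro filterlim_tendsto_pos_mult_at_top[OF tendsto_const _ harm_at_top])
    then have "filterlim (\<lambda>n. - s * harm n :: real) at_bot sequentially"
      by (simp add: filterlim_uminus_at_top)
    then show ?thesis
      by (rule filterlim_compose[OF exp_at_bot])
  qed
  then have "p \<longlonglongrightarrow> 0"
    by (rule tendsto_sandwich[rotated 2, OF tendsto_const]) (intro always_eventually allI p_nonneg p_le)+
  then have "(\<lambda>N. (1 - p N) / s) \<longlonglongrightarrow> (1 - 0) / s"
    using s by (intro tendsto_intros) auto
  moreover have "(\<lambda>N. (1 - p N) / s) = (\<lambda>N. \<Sum>n<N. coef s n)"
    using s by (simp flip: part)
  ultimately show ?thesis
    by (simp add: sums_def)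
qed

lemma Gamma_integral_Ioi:
  fixes z :: real
  assumes z: "0 < z"
  shows "integrable lborel (\<lambda>t. indicator {0<..} t * (exp (- t) * t powr (z - 1)))"
    and "(\<integral>t. indicator {0<..} t * (exp (- t) * t powr (z - 1)) \<partial>lborel) = Gamma z"
proof -
  let ?g = "\<lambda>t::real. indicator {0<..} t * (exp (- t) * t powr (z - 1)) :: real"
  have meas: "?g \<in> borel_measurable lborel" by measurable
  have "(\<integral>\<^sup>+t. ennreal (?g t) \<partial>lborel)
      = (\<integral>\<^sup>+t. ennreal (indicator {0..} t * t powr (z - 1) / exp t) \<partial>lborel)"
    by (intro nn_integral_cong) (auto simp: indicator_def exp_minus field_simps)
  also have "\<dots> = ennreal (Gamma z)"
    using Gamma_conv_nn_integral_real[OF z] by simp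
  finally have *: "(\<integral>\<^sup>+t. ennreal (?g t) \<partial>lborel) = ennreal (Gamma z)" .
  show "integrable lborel ?g"
    using meas * by (intro integrableI_nn_integral_finite) auto
  show "integral\<^sup>L lborel ?g = Gamma z"
    using meas * z by (subst integral_eq_nn_integral) (auto simp: Gamma_real_pos less_imp_le)
qed

text \<open>Term by term, the integrals are values of the Gamma function. Their ratios to the factorials are,
  up to the factor \<open>Gamma (1 - s)\<close>, the coefficients above, and the bound
  \<open>coef s n \<le> 1 / (n + 1)\<close> justifies the interchange.\<close>

lemma Gamma_series_integral:
  fixes a :: "nat \<Rightarrow> real"
  assumes s: "0 \<le> s" "s < 1" and bd: "\<And>n. \<bar>a n\<bar> \<le> B"
    and summ: "summable (\<lambda>n. \<bar>a n\<bar> / real (Suc n))"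
  shows "(LBINT t:{0<..}. exp (- t) * (\<Sum>n. t ^ Suc n / fact (Suc n) * a n) * t powr (- 1 - s))
    = Gamma (1 - s) * (\<Sum>n. coef s n * a n)"
proof -
  define f where "f n t = indicator {0<..} t * (exp (- t) * t powr (real (Suc n) - s - 1))
    * (a n / fact (Suc n))" for n and t :: real
  have pos: "0 < real (Suc n) - s" for n
    using s by simp
  have int: "integrable lborel (f n)" for n
    unfolding f_def by (intro integrable_mult_left Gamma_integral_Ioi pos)
  have val: "integral\<^sup>L lborel (f n) = Gamma (1 - s) * (coef s n * a n)" for n
  proof -
    have "integral\<^sup>L lborel (f n) = Gamma (real (Suc n) - s) * (a n / fact (Suc n))"
      unfolding f_def by (simp only: integral_mult_left_zero Gamma_integral_Ioi(2)[OF pos])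
    also have "\<dots> = Gamma (real (Suc n) - s) / fact (Suc n) * a n"
      by (simp only: times_divide_eq_right times_divide_eq_left)
    finally show ?thesis
      by (simp only: coef_Gamma[OF s] mult.assoc)
  qed
  have norm_val: "(\<integral>t. norm (f n t) \<partial>lborel) = Gamma (1 - s) * (coef s n * \<bar>a n\<bar>)" for n
  proof -
    have "(\<lambda>t. norm (f n t)) = (\<lambda>t. indicator {0<..} t * (exp (- t) * t powr (real (Suc n) - s - 1))
        * (\<bar>a n\<bar> / fact (Suc n)))"
      by (auto simp: f_def abs_mult)
    then have "(\<integral>t. norm (f n t) \<partial>lborel) = Gamma (real (Suc n) - s) * (\<bar>a n\<bar> / fact (Suc n))"
      by (simp only: integral_mult_left_zero Gamma_integral_Ioi(2)[OF pos])
    also have "\<dots> = Gamma (real (Suc n) - s) / fact (Suc n) * \<bar>a n\<bar>"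
      by (simp only: times_divide_eq_right times_divide_eq_left)
    finally show ?thesis
      by (simp only: coef_Gamma[OF s] mult.assoc)
  qed
  have f_eq: "f n t = exp (- t) * t powr (- 1 - s) * (t ^ Suc n / fact (Suc n) * a n)" if "0 < t" for n t
  proof -
    have "t powr (real (Suc n) - s - 1) = t powr (- 1 - s) * t ^ Suc n"
      using that by (simp add: powr_realpow[symmetric] flip: powr_add del: of_nat_Suc power_Suc)
        (simp add: algebra_simps)
    then show ?thesis
      using that by (simp add: f_def)
  qed
  have summ_pt: "summable (\<lambda>n. norm (t ^ Suc n / fact (Suc n) * a n))" for t :: real
  proof (rule summable_comparison_test)
    have "summable (\<lambda>n. norm (t ^ n / fact n))"
      using summable_norm_exp[of t] by (simp add: field_simps)
    then have "summable (\<lambda>n. norm (t ^ Suc n / fact (Suc n)))"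
      by (subst summable_Suc_iff)
    then show "summable (\<lambda>n. norm (t ^ Suc n / fact (Suc n)) * B)"
      by (rule summable_mult2)
    show "\<exists>N. \<forall>n\<ge>N. norm (norm (t ^ Suc n / fact (Suc n) * a n)) \<le> norm (t ^ Suc n / fact (Suc n)) * B"
      using bd by (auto simp: abs_mult simp del: fact_Suc power_Suc intro!: exI[of _ 0] mult_left_mono divide_right_mono)
  qed
  have f_zero: "f n t = 0" if "\<not> 0 < t" for n t
    using that by (simp add: f_def)
  have "(LBINT t:{0<..}. exp (- t) * (\<Sum>n. t ^ Suc n / fact (Suc n) * a n) * t powr (- 1 - s))
      = (\<integral>t. (\<Sum>n. f n t) \<partial>lborel)"
    unfolding set_lebesgue_integral_def
  proof (rule Bochner_Integration.integral_cong)
    fix t :: real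
    show "indicator {0<..} t *\<^sub>R (exp (- t) * (\<Sum>n. t ^ Suc n / fact (Suc n) * a n) * t powr (- 1 - s))
        = (\<Sum>n. f n t)"
    proof (cases "0 < t")
      case True
      have "(\<Sum>n. f n t) = exp (- t) * t powr (- 1 - s) * (\<Sum>n. t ^ Suc n / fact (Suc n) * a n)"
        unfolding f_eq[OF True] by (intro suminf_mult summable_norm_cancel[OF summ_pt])
      then show ?thesis using True by (simp add: mult_ac del: fact_Suc power_Suc)
    qed (simp add: f_zero)
  qed simp
  also have "\<dots> = (\<Sum>n. integral\<^sup>L lborel (f n))"
  proof (rule integral_suminf[OF int])
    show "AE t in lborel. summable (\<lambda>n. norm (f n t))"
    proof (rule AE_I2)
      fix t :: real
      show "summable (\<lambda>n. norm (f n t))"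
      proof (cases "0 < t")
        case True
        show ?thesis
          unfolding f_eq[OF True] norm_mult[of "exp (- t) * t powr (- 1 - s)"]
          by (intro summable_mult summ_pt)
      qed (simp add: f_zero)
    qed
    show "summable (\<lambda>n. \<integral>t. norm (f n t) \<partial>lborel)"
      unfolding norm_val
    proof (intro summable_mult summable_comparison_test[OF _ summ] exI[of _ 0] allI impI)
      fix n
      show "norm (coef s n * \<bar>a n\<bar>) \<le> \<bar>a n\<bar> / real (Suc n)"
        using coef_nonneg[OF s, of n] mult_right_mono[OF coef_le[OF s, of n], of "\<bar>a n\<bar>"]
        by (simp add: abs_mult)
    qed
  qed
  also have "\<dots> = Gamma (1 - s) * (\<Sum>n. coef s n * a n)"
    unfolding val
  proof (rule suminf_mult)
    show "summable (\<lambda>n. coef s n * a n)"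
    proof (intro summable_comparison_test[OF _ summ] exI[of _ 0] allI impI)
      fix n
      show "norm (coef s n * a n) \<le> \<bar>a n\<bar> / real (Suc n)"
        using coef_nonneg[OF s, of n] mult_right_mono[OF coef_le[OF s, of n], of "\<bar>a n\<bar>"]
        by (simp add: abs_mult)
    qed
  qed
  finally show ?thesis .
qed

section \<open>The transition operator\<close>

definition transition :: "(int ^ 'd \<Rightarrow> int ^ 'd \<Rightarrow> real) \<Rightarrow> (int ^ 'd \<Rightarrow> real) \<Rightarrow> int ^ 'd \<Rightarrow> real"
  where "transition w f x = (\<Sum>y | x \<sim>\<^sub>\<int> y. w x y * f y) / vmeas w x"

text \<open>The constant \<open>w0\<close> makes the walk uniformly elliptic; it also bounds \<open>vmeas w\<close> from below.\<close>

locale elliptic_lattice =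
  fixes w :: "int ^ 'd \<Rightarrow> int ^ 'd \<Rightarrow> real" and w0 :: real
  assumes lattice_weight: "lattice_weight w"
    and w0_pos: "0 < w0"
    and w_ge: "x \<sim>\<^sub>\<int> y \<Longrightarrow> w0 \<le> w x y"

lemma adj_sym: "x \<sim>\<^sub>\<int> y \<longleftrightarrow> y \<sim>\<^sub>\<int> x"
  by (simp add: adj_def abs_minus_commute)

lemma adj_plus_axis: "x \<sim>\<^sub>\<int> x + axis i c" if "\<bar>c\<bar> = 1"
proof -
  have "(\<Sum>j\<in>UNIV. \<bar>axis i c $ j\<bar>) = (\<Sum>j\<in>UNIV. if j = i then \<bar>c\<bar> else 0)"
    by (rule sum.cong) (auto simp: axis_def)
  then show ?thesis
    using that by (simp add: adj_def)
qed

context elliptic_lattice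
begin

abbreviation \<mu> :: "int ^ 'd \<Rightarrow> real" where "\<mu> \<equiv> vmeas w"

abbreviation P :: "(int ^ 'd \<Rightarrow> real) \<Rightarrow> int ^ 'd \<Rightarrow> real" where "P \<equiv> transition w"

lemma w_sym: "w x y = w y x"
  using lattice_weight by (simp add: lattice_weight_def)

lemma w_eq_0: "\<not> x \<sim>\<^sub>\<int> y \<Longrightarrow> w x y = 0"
  using lattice_weight by (simp add: lattice_weight_def)

lemma w_nonneg: "0 \<le> w x y"
  using lattice_weight by (cases "x \<sim>\<^sub>\<int> y") (auto simp: lattice_weight_def less_imp_le)

lemma \<mu>_ge: "w0 \<le> \<mu> x"
proof -
  fix i :: 'd
  have adj: "x \<sim>\<^sub>\<int> x + axis i 1"
    by (rule adj_plus_axis) simp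
  have "w0 \<le> w x (x + axis i 1)"
    using adj by (rule w_ge)
  also have "\<dots> \<le> \<mu> x"
    unfolding vmeas_def using adj by (intro member_le_sum) (auto simp: finite_adj w_nonneg)
  finally show ?thesis .
qed

lemma \<mu>_pos: "0 < \<mu> x"
  using \<mu>_ge[of x] w0_pos by linarith

lemma \<mu>_nonneg: "0 \<le> \<mu> x"
  using \<mu>_pos[of x] by linarith

lemma \<mu>_nz [simp]: "\<mu> x \<noteq> 0"
  using \<mu>_pos[of x] by linarith

lemma laplacian_eq: "laplacian w f = (\<lambda>x. P f x - f x)"
  by (rule ext)
    (simp add: laplacian_def transition_def right_diff_distrib sum_subtractf
      diff_divide_distrib vmeas_def[symmetric] flip: sum_distrib_right)

lemma \<mu>_P: "\<mu> x * P f x = (\<Sum>y | x \<sim>\<^sub>\<int> y. w x y * f y)"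
  by (simp add: transition_def)

lemma \<mu>_P_finite_support:
  assumes "finite A" "\<And>y. y \<notin> A \<Longrightarrow> f y = 0"
  shows "\<mu> x * P f x = (\<Sum>y\<in>A. w x y * f y)"
proof -
  have "(\<Sum>y | x \<sim>\<^sub>\<int> y. w x y * f y) = (\<Sum>y \<in> {y. x \<sim>\<^sub>\<int> y} \<inter> A. w x y * f y)"
    using assms by (intro sum.mono_neutral_right) (auto simp: finite_adj)
  also have "\<dots> = (\<Sum>y\<in>A. w x y * f y)"
    using assms w_eq_0[of x] by (intro sum.mono_neutral_left) auto
  finally show ?thesis by (simp add: \<mu>_P)
qed

lemma P_const: "P (\<lambda>_. c) x = c"
  by (simp add: transition_def vmeas_def[symmetric] flip: sum_distrib_right)

lemma P_mono: "(\<And>x. f x \<le> g x) \<Longrightarrow> P f x \<le> P g x"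
  unfolding transition_def
  by (intro divide_right_mono sum_mono mult_left_mono w_nonneg \<mu>_nonneg)

lemma P_diff: "P (\<lambda>x. f x - g x) x = P f x - P g x"
  by (simp add: transition_def right_diff_distrib sum_subtractf diff_divide_distrib)

lemma P_uminus: "P (\<lambda>x. - f x) x = - P f x"
  by (simp add: transition_def sum_negf)

lemma abs_P_le: "\<bar>P f x\<bar> \<le> P (\<lambda>x. \<bar>f x\<bar>) x"
proof (rule abs_leI)
  show "P f x \<le> P (\<lambda>x. \<bar>f x\<bar>) x"
    by (rule P_mono) simp
  show "- P f x \<le> P (\<lambda>x. \<bar>f x\<bar>) x"
    by (subst P_uminus[symmetric], rule P_mono) simp
qed

lemma P_funpow_const: "(P ^^ n) (\<lambda>_. c) x = c"
proof (induction n arbitrary: x)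
  case (Suc n)
  then have "(P ^^ n) (\<lambda>_. c) = (\<lambda>_. c)" by auto
  then show ?case by (simp add: P_const)
qed simp

lemma P_funpow_diff: "(P ^^ n) (\<lambda>x. f x - g x) x = (P ^^ n) f x - (P ^^ n) g x"
proof (induction n arbitrary: x)
  case (Suc n)
  have "(P ^^ n) (\<lambda>x. f x - g x) = (\<lambda>x. (P ^^ n) f x - (P ^^ n) g x)"
    using Suc by auto
  then show ?case by (simp add: P_diff)
qed simp

lemma P_funpow_nonneg: "(\<And>x. 0 \<le> f x) \<Longrightarrow> 0 \<le> (P ^^ n) f x"
proof (induction n arbitrary: x)
  case (Suc n)
  have "P (\<lambda>_. 0) x \<le> P ((P ^^ n) f) x"
    using Suc by (intro P_mono) auto
  then show ?case by (simp add: P_const)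
qed simp

lemma P_funpow_bounded: "(\<And>x. \<bar>f x\<bar> \<le> B) \<Longrightarrow> \<bar>(P ^^ n) f x\<bar> \<le> B"
proof (induction n arbitrary: x)
  case (Suc n)
  have "\<bar>P ((P ^^ n) f) x\<bar> \<le> P (\<lambda>x. \<bar>(P ^^ n) f x\<bar>) x"
    by (rule abs_P_le)
  also have "\<dots> \<le> P (\<lambda>_. B) x"
    using Suc by (intro P_mono) auto
  finally show ?case by (simp add: P_const)
qed simp

lemma P_Cc:
  assumes "f \<in> Cc"
  shows "P f \<in> Cc"
proof (rule Cc_I)
  show "finite (\<Union>y\<in>{y. f y \<noteq> 0}. {x. y \<sim>\<^sub>\<int> x})"
    using assms by (auto simp: Cc_def finite_adj)
  show "P f x = 0" if "x \<notin> (\<Union>y\<in>{y. f y \<noteq> 0}. {x. y \<sim>\<^sub>\<int> x})" for x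
    using that by (auto simp: transition_def adj_sym[of x] intro!: sum.neutral)
qed

lemma P_funpow_Cc: "f \<in> Cc \<Longrightarrow> (P ^^ n) f \<in> Cc"
  by (induction n) (auto simp: P_Cc)

text \<open>The value \<open>(P ^^ n) (indicator {y}) x\<close> is the probability of going from \<open>x\<close> to \<open>y\<close> in \<open>n\<close>
  steps. All sums behind it are finite, so \<open>v\<close> is arbitrary.\<close>

lemma has_sum_transition_probabilities:
  "((\<lambda>y. (P ^^ n) (indicator {y}) x * v y) has_sum (P ^^ n) v x) UNIV"
proof (induction n arbitrary: x)
  case 0
  have "((\<lambda>y. indicator {y} x * v y) has_sum v x) {x}"
    by (rule has_sum_finiteI) auto
  then show ?case
    by (subst has_sum_cong_neutral[where T = "{x}" and g = "\<lambda>y. indicator {y} x * v y"])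
      (auto simp: indicator_def)
next
  case (Suc n)
  have "((\<lambda>y. \<Sum>z | x \<sim>\<^sub>\<int> z. w x z / \<mu> x * ((P ^^ n) (indicator {y}) z * v y)) has_sum
      (\<Sum>z | x \<sim>\<^sub>\<int> z. w x z / \<mu> x * (P ^^ n) v z)) UNIV"
    by (intro has_sum_finite_sum has_sum_cmult_right Suc)
  moreover have "(P ^^ Suc n) g x = (\<Sum>z | x \<sim>\<^sub>\<int> z. w x z / \<mu> x * (P ^^ n) g z)" for g
    unfolding funpow.simps o_apply by (subst transition_def) (simp add: sum_divide_distrib)
  ultimately show ?case
    by (simp add: sum_distrib_right mult.assoc del: funpow.simps)
qed

text \<open>Reversibility: \<open>\<mu> x * P f x = (\<Sum>y. w x y * f y)\<close> with symmetric \<open>w\<close>. It is enough that one of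
  the two functions has finite support, which allows testing against constants.\<close>

lemma P_self_adjoint:
  assumes f: "f \<in> Cc"
  shows "(\<Sum>\<^sub>\<infinity>x. \<mu> x * P f x * g x) = (\<Sum>\<^sub>\<infinity>x. \<mu> x * f x * P g x)"
proof -
  define A where "A = {x. f x \<noteq> 0}"
  define B where "B = {x. P f x \<noteq> 0} \<union> (\<Union>y\<in>A. {x. y \<sim>\<^sub>\<int> x})"
  have fin: "finite A" "finite B"
    using f P_Cc[OF f] by (auto simp: Cc_def A_def B_def finite_adj)
  have "(\<Sum>\<^sub>\<infinity>x. \<mu> x * P f x * g x) = (\<Sum>x\<in>B. \<mu> x * P f x * g x)"
    using fin by (intro infsum_finite_support) (auto simp: B_def)
  also have "\<dots> = (\<Sum>x\<in>B. \<Sum>y\<in>A. w x y * f y * g x)"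
    using fin by (subst \<mu>_P_finite_support[of A]) (auto simp: A_def sum_distrib_right)
  also have "\<dots> = (\<Sum>y\<in>A. \<Sum>x\<in>B. w x y * f y * g x)"
    by (rule sum.swap)
  also have "\<dots> = (\<Sum>y\<in>A. \<mu> y * f y * P g y)"
  proof (rule sum.cong)
    fix y assume y: "y \<in> A"
    have "(\<Sum>x\<in>B. w x y * f y * g x) = (\<Sum>x | y \<sim>\<^sub>\<int> x. w x y * f y * g x)"
      using fin y by (intro sum.mono_neutral_right) (auto simp: B_def w_sym[of _ y] dest: w_eq_0)
    also have "\<dots> = f y * (\<Sum>x | y \<sim>\<^sub>\<int> x. w y x * g x)"
      by (simp add: sum_distrib_left w_sym[of _ y] mult_ac)
    finally show "(\<Sum>x\<in>B. w x y * f y * g x) = \<mu> y * f y * P g y"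
      by (simp flip: \<mu>_P)
  qed simp
  also have "\<dots> = (\<Sum>\<^sub>\<infinity>y. \<mu> y * f y * P g y)"
    using fin by (intro infsum_finite_support[symmetric]) (auto simp: A_def)
  finally show ?thesis .
qed

text \<open>By \<open>\<bar>P f\<bar> \<le> P \<bar>f\<bar>\<close> and the invariance of \<open>\<mu>\<close>.\<close>

lemma l1_contraction:
  assumes f: "f \<in> Cc"
  shows "(\<Sum>\<^sub>\<infinity>x. \<mu> x * \<bar>(P ^^ n) f x\<bar>) \<le> (\<Sum>\<^sub>\<infinity>x. \<mu> x * \<bar>f x\<bar>)"
proof (induction n)
  case (Suc n)
  define g where "g = (P ^^ n) f"
  have g: "g \<in> Cc" and abs_g: "(\<lambda>x. \<bar>g x\<bar>) \<in> Cc"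
    using P_funpow_Cc[OF f] by (auto simp: g_def intro: Cc_vanish[of "(P ^^ n) f"])
  have "(\<Sum>\<^sub>\<infinity>x. \<mu> x * \<bar>P g x\<bar>) \<le> (\<Sum>\<^sub>\<infinity>x. \<mu> x * P (\<lambda>x. \<bar>g x\<bar>) x * 1)"
    by (intro infsum_mono summable_on_Cc)
      (auto intro: Cc_vanish[OF P_Cc[OF g]] Cc_vanish[OF P_Cc[OF abs_g]]
        simp: abs_P_le mult_left_mono \<mu>_nonneg)
  also have "\<dots> = (\<Sum>\<^sub>\<infinity>x. \<mu> x * \<bar>g x\<bar> * P (\<lambda>_. 1) x)"
    by (rule P_self_adjoint[OF abs_g])
  also have "\<dots> \<le> (\<Sum>\<^sub>\<infinity>x. \<mu> x * \<bar>f x\<bar>)"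
    using Suc by (simp add: P_const g_def)
  finally show ?case by (simp add: g_def)
qed simp

section \<open>The heat semigroup as a Poisson mixture\<close>

text \<open>This is the binomial formula for \<open>(P - 1)\<^sup>n\<close>.\<close>

lemma laplacian_funpow:
  "(laplacian w ^^ n) f x = (\<Sum>k\<le>n. real (n choose k) * (- 1) ^ (n - k) * (P ^^ k) f x)"
proof (induction n arbitrary: f)
  case (Suc n)
  define b where "b k = (P ^^ k) f x" for k
  have P_step: "(P ^^ k) (laplacian w f) x = b (Suc k) - b k" for k
    unfolding b_def laplacian_eq P_funpow_diff by (simp only: funpow_Suc_right o_apply)
  \<comment> \<open>Multiplying the alternating sum by \<open>-1\<close> raises the exponent of \<open>-1\<close>; the missing term \<open>k = 0\<close>
    and the vanishing term \<open>k = n + 1\<close> account for the index shift.\<close>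
  have shift: "(\<Sum>k\<le>n. real (n choose Suc k) * (- 1) ^ (n - k) * b (Suc k)) + (- 1) ^ Suc n * b 0
      = - (\<Sum>k\<le>n. real (n choose k) * (- 1) ^ (n - k) * b k)"
  proof -
    have "(\<Sum>k\<le>n. real (n choose Suc k) * (- 1) ^ (n - k) * b (Suc k)) + (- 1) ^ Suc n * b 0
        = (\<Sum>k\<le>Suc n. real (n choose k) * (- 1) ^ (Suc n - k) * b k)"
      by (subst sum.atMost_Suc_shift) simp
    also have "\<dots> = (\<Sum>k\<le>n. real (n choose k) * (- 1) ^ (Suc n - k) * b k)"
      by simp
    also have "\<dots> = (\<Sum>k\<le>n. - (real (n choose k) * (- 1) ^ (n - k) * b k))"
      by (intro sum.cong) (auto simp: Suc_diff_le)
    finally show ?thesis by (simp add: sum_negf)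
  qed
  have "(laplacian w ^^ Suc n) f x
      = (\<Sum>k\<le>n. real (n choose k) * (- 1) ^ (n - k) * (b (Suc k) - b k))"
    by (simp only: funpow_Suc_right o_apply Suc P_step)
  also have "\<dots> = (\<Sum>k\<le>n. real (n choose k) * (- 1) ^ (n - k) * b (Suc k))
      + (\<Sum>k\<le>n. real (n choose Suc k) * (- 1) ^ (n - k) * b (Suc k)) + (- 1) ^ Suc n * b 0"
    unfolding right_diff_distrib sum_subtractf using shift by linarith
  also have "\<dots> = (- 1) ^ Suc n * b 0
      + (\<Sum>k\<le>n. real (Suc n choose Suc k) * (- 1) ^ (Suc n - Suc k) * b (Suc k))"
    by (simp add: sum.distrib algebra_simps)
  also have "\<dots> = (\<Sum>k\<le>Suc n. real (Suc n choose k) * (- 1) ^ (Suc n - k) * b k)"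
    by (subst sum.atMost_Suc_shift) simp
  finally show ?case by (simp only: b_def)
qed simp

lemma summable_exp_weighted:
  fixes a :: "nat \<Rightarrow> real"
  assumes "\<And>n. \<bar>a n\<bar> \<le> B"
  shows "summable (\<lambda>n. norm (t ^ n / fact n * a n))"
proof (rule summable_comparison_test)
  have "summable (\<lambda>n. norm (t ^ n / fact n))"
    using summable_norm_exp[of t] by (simp add: field_simps)
  then show "summable (\<lambda>n. norm (t ^ n / fact n) * B)"
    by (rule summable_mult2)
  show "\<exists>N. \<forall>n\<ge>N. norm (norm (t ^ n / fact n * a n)) \<le> norm (t ^ n / fact n) * B"
    using assms by (auto simp: abs_mult intro!: exI[of _ 0] mult_left_mono divide_right_mono)
qed

text \<open>The continuous-time walk is \<open>P\<close> run at the jump times of a Poisson process: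
  \<open>exp (t (P - 1)) = exp (- t) exp (t P)\<close>. Pointwise this is the Cauchy product of the series of
  \<open>exp (t P)\<close> and of \<open>exp (- t)\<close>.\<close>

lemma heat_semigroup_eq:
  assumes "\<And>x. \<bar>f x\<bar> \<le> B"
  shows "heat_semigroup w t f x = exp (- t) * (\<Sum>n. t ^ n / fact n * (P ^^ n) f x)"
proof -
  have B: "\<bar>(P ^^ n) f x\<bar> \<le> B" for n
    using assms by (rule P_funpow_bounded)
  have exp_sum: "(\<Sum>n. (- t) ^ n / fact n) = exp (- t)"
    by (simp add: exp_def divide_inverse mult.commute)
  have "(\<Sum>n. t ^ n / fact n * (P ^^ n) f x) * (\<Sum>n. (- t) ^ n / fact n)
      = (\<Sum>n. \<Sum>k\<le>n. t ^ k / fact k * (P ^^ k) f x * ((- t) ^ (n - k) / fact (n - k)))"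
    using summable_exp_weighted[where a = "\<lambda>n. (P ^^ n) f x" and B = B and t = t, OF B]
      summable_norm_exp[of "- t"]
    by (intro Cauchy_product) (simp_all add: field_simps)
  also have "(\<lambda>n. \<Sum>k\<le>n. t ^ k / fact k * (P ^^ k) f x * ((- t) ^ (n - k) / fact (n - k)))
      = (\<lambda>n. t ^ n / fact n * (laplacian w ^^ n) f x)"
  proof
    fix n
    show "(\<Sum>k\<le>n. t ^ k / fact k * (P ^^ k) f x * ((- t) ^ (n - k) / fact (n - k)))
        = t ^ n / fact n * (laplacian w ^^ n) f x"
      unfolding laplacian_funpow sum_distrib_left
    proof (rule sum.cong)
      fix k assume "k \<in> {..n}"
      then have kn: "k \<le> n" by simp
      have 1: "(- t) ^ (n - k) = (- 1) ^ (n - k) * t ^ (n - k)"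
        by (metis power_mult_distrib mult_minus1)
      have 2: "t ^ n = t ^ k * t ^ (n - k)"
        using kn by (simp flip: power_add)
      show "t ^ k / fact k * (P ^^ k) f x * ((- t) ^ (n - k) / fact (n - k))
          = t ^ n / fact n * (real (n choose k) * (- 1) ^ (n - k) * (P ^^ k) f x)"
        unfolding 1 2 binomial_fact[OF kn] by simp
    qed simp
  qed
  finally show ?thesis
    unfolding heat_semigroup_def exp_sum by (simp add: mult.commute)
qed

text \<open>Without its jump-free part \<open>exp (- t) u\<close> the semigroup vanishes to first order at \<open>t = 0\<close>; this
  makes the integrals against \<open>t\<^sup>-\<^sup>1\<^sup>-\<^sup>s\<close> converge there.\<close>

lemma heat_semigroup_split:
  assumes "\<And>x. \<bar>u x\<bar> \<le> B"
  shows "heat_semigroup w t u x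
    = exp (- t) * u x + exp (- t) * (\<Sum>n. t ^ Suc n / fact (Suc n) * (P ^^ Suc n) u x)"
proof -
  have "summable (\<lambda>n. t ^ n / fact n * (P ^^ n) u x)"
    using assms by (intro summable_norm_cancel[OF summable_exp_weighted[where B = B]] P_funpow_bounded)
  then have "(\<Sum>n. t ^ n / fact n * (P ^^ n) u x)
      = u x + (\<Sum>n. t ^ Suc n / fact (Suc n) * (P ^^ Suc n) u x)"
    by (subst suminf_split_head) auto
  then show ?thesis
    unfolding heat_semigroup_eq[OF assms] by (simp only: distrib_left)
qed

section \<open>Decay of the powers of the transition operator\<close>

definition energy :: "(int ^ 'd \<Rightarrow> real) \<Rightarrow> real"
  where "energy f = (\<Sum>\<^sub>\<infinity>x. \<mu> x * (f x)\<^sup>2)"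

lemma energy_nonneg: "0 \<le> energy f"
  unfolding energy_def by (intro infsum_nonneg mult_nonneg_nonneg \<mu>_nonneg) simp

lemma energy_summable: "f \<in> Cc \<Longrightarrow> (\<lambda>x. \<mu> x * (f x)\<^sup>2) summable_on UNIV"
  by (intro summable_on_Cc) (auto elim: Cc_vanish)

lemma sum_squares_le_energy:
  assumes "f \<in> Cc" "finite X"
  shows "(\<Sum>x\<in>X. (f x)\<^sup>2) \<le> energy f / w0"
proof -
  have "w0 * (\<Sum>x\<in>X. (f x)\<^sup>2) \<le> (\<Sum>x\<in>X. \<mu> x * (f x)\<^sup>2)"
    unfolding sum_distrib_left by (intro sum_mono mult_right_mono \<mu>_ge) simp
  also have "\<dots> \<le> energy f"
    unfolding energy_def using assms
    by (intro finite_sum_le_infsum energy_summable) (auto intro: mult_nonneg_nonneg \<mu>_nonneg)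
  finally show ?thesis
    using w0_pos by (simp add: field_simps)
qed

text \<open>The right-hand side is \<open>\<mu> x\<close> times the variance of \<open>f\<close> after one step from \<open>x\<close>. The two
  neighbours \<open>x + e\<^sub>i\<close> and \<open>x - e\<^sub>i\<close> are both charged by this step. Since \<open>P\<close>
  does not damp an alternation in sign between the two classes of the bipartite lattice, the variances
  cannot control the differences across a single edge.\<close>

lemma variance_lower_bound:
  "w0 / 2 * (f (x + axis i 1) - f (x - axis i 1))\<^sup>2 \<le> \<mu> x * P (\<lambda>y. (f y)\<^sup>2) x - \<mu> x * (P f x)\<^sup>2"
proof -
  define m where "m = P f x"
  define a where "a = x + axis i 1"
  define b where "b = x - axis i 1"
  have b_eq: "b = x + axis i (- 1)"
    by (simp add: b_def vec_eq_iff axis_def)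
  have adj: "x \<sim>\<^sub>\<int> a" "x \<sim>\<^sub>\<int> b"
    unfolding a_def b_eq by (rule adj_plus_axis; simp)+
  have "a $ i \<noteq> b $ i"
    by (simp add: a_def b_def)
  then have ab: "a \<noteq> b" by auto
  have "w0 / 2 * (f a - f b)\<^sup>2 \<le> w0 * (f a - m)\<^sup>2 + w0 * (f b - m)\<^sup>2"
  proof -
    have "(f a - f b)\<^sup>2 \<le> 2 * ((f a - m)\<^sup>2 + (f b - m)\<^sup>2)"
      using zero_le_power2[of "f a + f b - 2 * m"] by (simp add: power2_eq_square algebra_simps)
    then show ?thesis
      using mult_left_mono[of "(f a - f b)\<^sup>2" "2 * ((f a - m)\<^sup>2 + (f b - m)\<^sup>2)" "w0 / 2"] w0_pos
      by (simp add: algebra_simps)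
  qed
  \<comment> \<open>Of the variance around \<open>m\<close>, only the terms of the two neighbours are kept.\<close>
  also have "\<dots> \<le> (\<Sum>y\<in>{a, b}. w x y * (f y - m)\<^sup>2)"
    using ab adj by (auto intro!: add_mono mult_right_mono w_ge)
  also have "\<dots> \<le> (\<Sum>y | x \<sim>\<^sub>\<int> y. w x y * (f y - m)\<^sup>2)"
    using adj by (intro sum_mono2) (auto simp: finite_adj w_nonneg)
  also have "\<dots> = (\<Sum>y | x \<sim>\<^sub>\<int> y. w x y * (f y)\<^sup>2) - 2 * m * (\<Sum>y | x \<sim>\<^sub>\<int> y. w x y * f y)
      + m\<^sup>2 * (\<Sum>y | x \<sim>\<^sub>\<int> y. w x y)"
    by (simp add: sum_distrib_left sum_subtractf[symmetric] sum.distrib[symmetric]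
        power2_eq_square algebra_simps)
  also have "\<dots> = \<mu> x * P (\<lambda>y. (f y)\<^sup>2) x - 2 * m * (\<mu> x * P f x) + m\<^sup>2 * \<mu> x"
    by (simp only: \<mu>_P, simp only: vmeas_def)
  also have "\<dots> = \<mu> x * P (\<lambda>y. (f y)\<^sup>2) x - \<mu> x * (P f x)\<^sup>2"
    by (simp add: m_def power2_eq_square)
  finally show ?thesis unfolding a_def b_def .
qed

text \<open>Summing the one-step variances: by the invariance of \<open>\<mu>\<close>, the variances add up to the energy that
  one application of \<open>P\<close> destroys. The statement with finite sets avoids the summability of the
  gradient term.\<close>

lemma energy_dissipation:
  assumes f: "f \<in> Cc" and X: "finite X"
  shows "w0 / 2 * (\<Sum>x\<in>X. (f (x + axis i 1) - f (x - axis i 1))\<^sup>2) \<le> energy f - energy (P f)"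
proof -
  define D where "D x = \<mu> x * P (\<lambda>y. (f y)\<^sup>2) x - \<mu> x * (P f x)\<^sup>2" for x
  have sq: "(\<lambda>y. (f y)\<^sup>2) \<in> Cc"
    using f by (rule Cc_vanish) simp
  have summ: "(\<lambda>x. \<mu> x * P (\<lambda>y. (f y)\<^sup>2) x) summable_on UNIV"
    by (intro summable_on_Cc) (auto intro: Cc_vanish[OF P_Cc[OF sq]])
  have D_nonneg: "0 \<le> D x" for x
    using variance_lower_bound[of f x i] w0_pos unfolding D_def
    by (meson mult_nonneg_nonneg order_trans zero_le_power2 less_imp_le half_gt_zero)
  have "w0 / 2 * (\<Sum>x\<in>X. (f (x + axis i 1) - f (x - axis i 1))\<^sup>2) \<le> (\<Sum>x\<in>X. D x)"
    unfolding sum_distrib_left D_def by (intro sum_mono variance_lower_bound)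
  also have "\<dots> \<le> (\<Sum>\<^sub>\<infinity>x. D x)"
    unfolding D_def using summ D_nonneg X
    by (intro finite_sum_le_infsum summable_on_diff_real energy_summable P_Cc f) (auto simp: D_def)
  also have "\<dots> = (\<Sum>\<^sub>\<infinity>x. \<mu> x * P (\<lambda>y. (f y)\<^sup>2) x) - energy (P f)"
    unfolding D_def energy_def by (intro infsum_diff_real summ energy_summable P_Cc f)
  \<comment> \<open>The measure \<open>\<mu>\<close> is invariant: self-adjointness against the constant function 1.\<close>
  also have "(\<Sum>\<^sub>\<infinity>x. \<mu> x * P (\<lambda>y. (f y)\<^sup>2) x) = energy f"
    using P_self_adjoint[OF sq, of "\<lambda>_. 1"] by (simp add: P_const energy_def)
  finally show ?thesis .
qed

text \<open>A one-dimensional Sobolev inequality. Along a ray from \<open>x\<close> the function \<open>f\<^sup>2\<close> goes from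
  \<open>(f x)\<^sup>2\<close> to 0, so \<open>(f x)\<^sup>2\<close> is a telescoping sum of terms \<open>(a - b) (a + b)\<close>. The Cauchy-Schwarz
  inequality bounds it by the dissipation of energy and the energy itself.\<close>

lemma pow4_le_energy:
  assumes f: "f \<in> Cc"
  shows "(f x) ^ 4 \<le> 8 / w0\<^sup>2 * (energy f - energy (P f)) * energy f"
proof -
  fix i :: 'd
  \<comment> \<open>The ray advances in steps of 2, and \<open>c j\<close> is the midpoint of its \<open>j\<close>-th step.\<close>
  define r where "r j = x + axis i (2 * int j)" for j
  define c where "c j = x + axis i (2 * int j + 1)" for j
  have r_c: "r j = c j - axis i 1" "r (Suc j) = c j + axis i 1" for j
    by (auto simp: r_def c_def vec_eq_iff axis_def)
  have "inj r" "inj c"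
    by (auto intro!: injI simp: r_def c_def axis_eq_axis)
  have "finite (r -` {y. f y \<noteq> 0})"
    using f \<open>inj r\<close> by (intro finite_vimageI) (auto simp: Cc_def)
  then obtain J where "J \<notin> r -` {y. f y \<noteq> 0}"
    using infinite_UNIV_nat by (metis ex_new_if_finite)
  then have J: "f (r J) = 0" by simp
  have sum_r: "(\<Sum>j<n. (f (r (j + m)))\<^sup>2) \<le> energy f / w0" for n m
  proof -
    have "(\<Sum>j<n. (f (r (j + m)))\<^sup>2) = (\<Sum>y\<in>(\<lambda>j. r (j + m)) ` {..<n}. (f y)\<^sup>2)"
      using \<open>inj r\<close> by (subst sum.reindex) (auto intro!: inj_onI dest: injD)
    also have "\<dots> \<le> energy f / w0"
      using f by (rule sum_squares_le_energy) simp
    finally show ?thesis .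
  qed
  have "r 0 = x"
    by (simp add: r_def axis_def vec_eq_iff)
  then have "(f x)\<^sup>2 = (f (r 0))\<^sup>2 - (f (r J))\<^sup>2"
    using J by simp
  also have "\<dots> = (\<Sum>j<J. (f (r j))\<^sup>2 - (f (r (Suc j)))\<^sup>2)"
    by (rule sum_lessThan_telescope'[symmetric])
  also have "\<dots> = (\<Sum>j<J. (f (r (Suc j)) - f (r j)) * - (f (r (Suc j)) + f (r j)))"
    by (intro sum.cong) (auto simp: power2_eq_square algebra_simps)
  finally have sq: "(f x)\<^sup>2 = (\<Sum>j<J. (f (r (Suc j)) - f (r j)) * - (f (r (Suc j)) + f (r j)))" .
  have "(f x) ^ 4 = ((f x)\<^sup>2)\<^sup>2"
    using power_mult[of "f x" 2 2] by simp
  also have "\<dots> = (\<Sum>j<J. (f (r (Suc j)) - f (r j)) * - (f (r (Suc j)) + f (r j)))\<^sup>2"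
    by (simp only: sq)
  also have "\<dots> \<le> (\<Sum>j<J. (f (r (Suc j)) - f (r j))\<^sup>2) * (\<Sum>j<J. (- (f (r (Suc j)) + f (r j)))\<^sup>2)"
    by (rule Cauchy_Schwarz_ineq_sum)
  also have "\<dots> \<le> (2 / w0 * (energy f - energy (P f))) * (4 / w0 * energy f)"
  proof (rule mult_mono)
    have "(\<Sum>j<J. (f (r (Suc j)) - f (r j))\<^sup>2)
        = (\<Sum>y\<in>c ` {..<J}. (f (y + axis i 1) - f (y - axis i 1))\<^sup>2)"
      using \<open>inj c\<close> by (subst sum.reindex) (auto simp flip: r_c intro!: inj_onI dest: injD)
    also have "\<dots> \<le> 2 / w0 * (energy f - energy (P f))"
      using energy_dissipation[OF f, of "c ` {..<J}" i] w0_pos by (simp add: field_simps)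
    finally show "(\<Sum>j<J. (f (r (Suc j)) - f (r j))\<^sup>2) \<le> 2 / w0 * (energy f - energy (P f))" .
    have "(\<Sum>j<J. (- (f (r (Suc j)) + f (r j)))\<^sup>2)
        \<le> (\<Sum>j<J. 2 * (f (r (j + 1)))\<^sup>2 + 2 * (f (r (j + 0)))\<^sup>2)"
    proof (intro sum_mono)
      fix j
      show "(- (f (r (Suc j)) + f (r j)))\<^sup>2 \<le> 2 * (f (r (j + 1)))\<^sup>2 + 2 * (f (r (j + 0)))\<^sup>2"
        using zero_le_power2[of "f (r (Suc j)) - f (r j)"]
        by (simp add: power2_eq_square algebra_simps)
    qed
    also have "\<dots> \<le> 2 * (energy f / w0) + 2 * (energy f / w0)"
      unfolding sum.distrib sum_distrib_left[symmetric]
      by (intro add_mono mult_left_mono sum_r) auto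
    finally show "(\<Sum>j<J. (- (f (r (Suc j)) + f (r j)))\<^sup>2) \<le> 4 / w0 * energy f"
      by simp
    show "0 \<le> 2 / w0 * (energy f - energy (P f))"
      using energy_dissipation[OF f, of "{}" i] w0_pos by simp
  qed (auto intro: sum_nonneg)
  finally show ?thesis
    by (simp add: power2_eq_square mult_ac)
qed

text \<open>The second difference \<open>energy f - 2 energy (P f) + energy (P\<^sup>2 f)\<close> equals \<open>energy (f - P\<^sup>2 f)\<close>,
  because \<open>\<parallel>P f\<parallel>\<^sup>2 = \<langle>f, P\<^sup>2 f\<rangle>\<close>.\<close>

lemma energy_convex:
  assumes f: "f \<in> Cc"
  shows "2 * energy (P f) \<le> energy f + energy (P (P f))"
proof -
  define g where "g = P (P f)"
  have g: "g \<in> Cc" unfolding g_def by (intro P_Cc f)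
  have cross: "(\<lambda>x. 2 * (\<mu> x * f x * g x)) summable_on UNIV"
    by (intro summable_on_Cc) (auto intro: Cc_vanish[OF f])
  have "energy (P f) = (\<Sum>\<^sub>\<infinity>x. \<mu> x * f x * g x)"
    using P_self_adjoint[OF f, of "P f"] by (simp add: energy_def g_def power2_eq_square mult_ac)
  then have "energy f + energy g - 2 * energy (P f)
      = (\<Sum>\<^sub>\<infinity>x. \<mu> x * (f x)\<^sup>2 + \<mu> x * (g x)\<^sup>2 - 2 * (\<mu> x * f x * g x))"
    using energy_summable[OF f] energy_summable[OF g] cross
    by (simp add: energy_def infsum_add infsum_diff_real summable_on_add infsum_cmult_right')
  also have "\<dots> = (\<Sum>\<^sub>\<infinity>x. \<mu> x * (f x - g x)\<^sup>2)"
    by (simp add: power2_eq_square algebra_simps)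
  also have "\<dots> \<ge> 0"
    by (intro infsum_nonneg mult_nonneg_nonneg \<mu>_nonneg) simp
  finally show ?thesis by (simp add: g_def)
qed

text \<open>The energies of \<open>f, P f, P\<^sup>2 f, \<dots>\<close> form a convex sequence, so the \<open>n\<close>-th step dissipates at
  most \<open>energy f / (n + 1)\<close>; the Sobolev inequality turns this into a bound on the fourth power of
  \<open>(P ^^ n) f\<close>. The exponent is not optimal, but any positive one is enough for the sequel.\<close>

lemma P_funpow_sup_decay:
  assumes f: "f \<in> Cc"
  obtains C where "0 < C" "\<And>n x. \<bar>(P ^^ n) f x\<bar> \<le> C * real (Suc n) powr (- 1 / 4)"
proof
  define a where "a n = energy ((P ^^ n) f)" for n
  define K where "K = 8 / w0\<^sup>2 * (a 0)\<^sup>2"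
  have K: "0 \<le> K" by (simp add: K_def)
  have a_nonneg: "0 \<le> a n" for n
    by (simp add: a_def energy_nonneg)
  have a_mono: "a (Suc n) \<le> a n" for n
    using energy_dissipation[OF P_funpow_Cc[OF f], of "{}"] by (simp add: a_def)
  have a_le: "a n \<le> a 0" for n
    by (induction n) (use a_mono order_trans in blast)+
  have a_dec: "a n - a (Suc n) \<le> a 0 / real (Suc n)" for n
  proof (rule convex_seq_decrement_le)
    show "2 * a (Suc k) \<le> a k + a (Suc (Suc k))" for k
      using energy_convex[OF P_funpow_Cc[OF f]] by (simp add: a_def)
  qed (rule a_nonneg)
  \<comment> \<open>The added 1 keeps the constant positive when \<open>f = 0\<close>.\<close>
  show "0 < K powr (1 / 4) + 1"
    by (simp add: add_nonneg_pos)
  show "\<bar>(P ^^ n) f x\<bar> \<le> (K powr (1 / 4) + 1) * real (Suc n) powr (- 1 / 4)" for n x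
  proof -
    have "\<bar>(P ^^ n) f x\<bar> ^ 4 \<le> 8 / w0\<^sup>2 * (a n - a (Suc n)) * a n"
      using pow4_le_energy[OF P_funpow_Cc[OF f], of n x] by (simp add: a_def)
    also have "\<dots> \<le> 8 / w0\<^sup>2 * (a 0 / real (Suc n)) * a 0"
      using a_nonneg a_le a_dec a_mono by (intro mult_mono mult_nonneg_nonneg) auto
    also have "\<dots> = K / real (Suc n)"
      by (simp add: K_def power2_eq_square)
    finally have "(\<bar>(P ^^ n) f x\<bar> ^ 4) powr (1 / 4) \<le> (K / real (Suc n)) powr (1 / 4)"
      by (intro powr_mono2) auto
    moreover have "(\<bar>(P ^^ n) f x\<bar> ^ 4) powr (1 / 4) = \<bar>(P ^^ n) f x\<bar>"
      by (cases "(P ^^ n) f x = 0") (simp_all add: powr_powr flip: powr_numeral)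
    moreover have "(K / real (Suc n)) powr (1 / 4) = K powr (1 / 4) * real (Suc n) powr (- 1 / 4)"
      using K by (simp add: powr_divide powr_minus_divide)
    ultimately have "\<bar>(P ^^ n) f x\<bar> \<le> K powr (1 / 4) * real (Suc n) powr (- 1 / 4)"
      by simp
    also have "\<dots> \<le> (K powr (1 / 4) + 1) * real (Suc n) powr (- 1 / 4)"
      by (intro mult_right_mono) auto
    finally show ?thesis .
  qed
qed

text \<open>Interpolation between the \<open>\<ell>\<^sup>1\<close> contraction and the decay of the supremum:
  \<open>\<bar>g\<bar>\<^sup>r \<le> \<bar>g\<bar> (sup \<bar>g\<bar>)\<^sup>r\<^sup>-\<^sup>1\<close>. The exponent is positive exactly because \<open>r > 1\<close>.\<close>

lemma P_funpow_lp_decay: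
  assumes f: "f \<in> Cc" and r: "1 < r"
  obtains C where "0 < C"
    "\<And>n X. finite X \<Longrightarrow> (\<Sum>x\<in>X. \<mu> x * \<bar>(P ^^ n) f x\<bar> powr r)
       \<le> (C * real (Suc n) powr (- (r - 1) / (4 * r))) powr r"
proof -
  obtain C where C: "0 < C" "\<And>n x. \<bar>(P ^^ n) f x\<bar> \<le> C * real (Suc n) powr (- 1 / 4)"
    using P_funpow_sup_decay[OF f] by metis
  \<comment> \<open>The added 1 keeps the constant positive when \<open>f = 0\<close>.\<close>
  define L where "L = (\<Sum>\<^sub>\<infinity>x. \<mu> x * \<bar>f x\<bar>) + 1"
  have "0 < L"
    unfolding L_def by (intro add_nonneg_pos infsum_nonneg mult_nonneg_nonneg \<mu>_nonneg) auto
  show thesis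
  proof
    show "0 < (C powr (r - 1) * L) powr (1 / r)"
      using C \<open>0 < L\<close> by simp
    fix n and X :: "(int ^ 'd) set"
    assume X: "finite X"
    define g where "g = (P ^^ n) f"
    define N where "N = real (Suc n)"
    have N: "0 < N" by (simp add: N_def)
    have g: "\<bar>g x\<bar> \<le> C * N powr (- 1 / 4)" for x
      using C by (simp add: g_def N_def)
    have summ: "(\<lambda>x. \<mu> x * \<bar>g x\<bar>) summable_on UNIV"
      unfolding g_def by (intro summable_on_Cc) (auto intro: Cc_vanish[OF P_funpow_Cc[OF f]])
    have "(\<Sum>x\<in>X. \<mu> x * \<bar>g x\<bar> powr r) \<le> (\<Sum>x\<in>X. \<mu> x * \<bar>g x\<bar> * (C * N powr (- 1 / 4)) powr (r - 1))"
    proof (rule sum_mono)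
      fix x
      have "\<bar>g x\<bar> powr r = \<bar>g x\<bar> * \<bar>g x\<bar> powr (r - 1)"
        using r by (cases "g x = 0") (simp_all add: powr_mult_base)
      also have "\<dots> \<le> \<bar>g x\<bar> * (C * N powr (- 1 / 4)) powr (r - 1)"
        using g r by (intro mult_left_mono powr_mono2) auto
      finally show "\<mu> x * \<bar>g x\<bar> powr r \<le> \<mu> x * \<bar>g x\<bar> * (C * N powr (- 1 / 4)) powr (r - 1)"
        using \<mu>_nonneg[of x] by (simp add: mult_left_mono mult.assoc)
    qed
    also have "\<dots> \<le> L * (C * N powr (- 1 / 4)) powr (r - 1)"
      unfolding sum_distrib_right[symmetric]
    proof (rule mult_right_mono)
      have "(\<Sum>x\<in>X. \<mu> x * \<bar>g x\<bar>) \<le> (\<Sum>\<^sub>\<infinity>x. \<mu> x * \<bar>g x\<bar>)"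
        using X summ by (intro finite_sum_le_infsum) (auto intro: mult_nonneg_nonneg \<mu>_nonneg)
      also have "\<dots> \<le> L"
        using l1_contraction[OF f, of n] by (simp add: g_def L_def)
      finally show "(\<Sum>x\<in>X. \<mu> x * \<bar>g x\<bar>) \<le> L" .
    qed simp
    also have "\<dots> = C powr (r - 1) * L * N powr (- 1 / 4 * (r - 1))"
      using C N by (simp only: powr_mult powr_powr less_imp_le powr_ge_zero mult_ac)
    also have "\<dots> = (C powr (r - 1) * L) powr (1 / r * r) * N powr (- (r - 1) / (4 * r) * r)"
    proof -
      have "1 / r * r = 1" "- (r - 1) / (4 * r) * r = - 1 / 4 * (r - 1)"
        using r by (auto simp: field_simps)
      then show ?thesis
        using C \<open>0 < L\<close> by simp
    qed
    also have "\<dots> = ((C powr (r - 1) * L) powr (1 / r) * N powr (- (r - 1) / (4 * r))) powr r"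
      by (simp only: powr_mult powr_powr powr_ge_zero mult.assoc)
    finally show "(\<Sum>x\<in>X. \<mu> x * \<bar>(P ^^ n) f x\<bar> powr r)
        \<le> ((C powr (r - 1) * L) powr (1 / r) * real (Suc n) powr (- (r - 1) / (4 * r))) powr r"
      by (simp add: g_def N_def)
  qed
qed

section \<open>Minkowski bounds for series of functions\<close>

text \<open>A bound on the \<open>\<ell>\<^sup>p\<close> norm that contains membership in \<open>\<ell>\<^sup>p\<close>: with finite partial sums no
  summability has to be known beforehand.\<close>

definition lp_le :: "ereal \<Rightarrow> (int ^ 'd \<Rightarrow> real) \<Rightarrow> real \<Rightarrow> bool"
  where "lp_le p f M \<longleftrightarrow>
    (if p = \<infinity> then \<forall>x. \<bar>f x\<bar> \<le> M
     else \<forall>X. finite X \<longrightarrow>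
       (\<Sum>x\<in>X. \<mu> x * \<bar>f x\<bar> powr real_of_ereal p) \<le> M powr real_of_ereal p)"

lemma one_less_ereal_cases:
  fixes p :: ereal
  assumes "1 < p"
  obtains "p = \<infinity>" | r where "p = ereal r" "1 < r"
  using assms by (cases p) (auto simp: one_ereal_def)

lemma lp_le_imp_lp_space:
  assumes p: "1 < p" and f: "lp_le p f M" and M: "0 \<le> M"
  shows "f \<in> lp_space w p \<and> 0 \<le> lp_norm w p f \<and> lp_norm w p f \<le> M"
  using p
proof (cases rule: one_less_ereal_cases)
  case 1
  have le: "\<bar>f x\<bar> \<le> M" for x
    using f 1 by (simp add: lp_le_def)
  then have bdd: "bdd_above (range (\<lambda>x. \<bar>f x\<bar>))"
    by (auto intro!: bdd_aboveI)
  have in_lp: "f \<in> lp_space w p"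
    using le 1 by (auto simp: lp_space_def intro!: boundedI)
  have "0 \<le> \<bar>f 0\<bar>" by simp
  also have "\<dots> \<le> (SUP x. \<bar>f x\<bar>)"
    by (rule cSUP_upper[OF UNIV_I bdd])
  finally have nonneg: "0 \<le> lp_norm w p f"
    using 1 by (simp add: lp_norm_def)
  have "lp_norm w p f \<le> M"
    using le 1 by (auto simp: lp_norm_def intro!: cSUP_least)
  with in_lp nonneg show ?thesis by blast
next
  case (2 r)
  have le: "(\<Sum>x\<in>X. \<bar>f x\<bar> powr r * \<mu> x) \<le> M powr r" if "finite X" for X
    using f 2 that by (simp add: lp_le_def mult.commute)
  have summ: "(\<lambda>x. \<bar>f x\<bar> powr r * \<mu> x) summable_on UNIV"
    using le by (intro nonneg_bdd_above_summable_on bdd_aboveI2[where M = "M powr r"]) (auto simp: \<mu>_nonneg)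
  then have in_lp: "f \<in> lp_space w p"
    using 2 by (simp add: lp_space_def)
  have nonneg: "0 \<le> lp_norm w p f"
    using 2 by (simp add: lp_norm_def)
  have "(\<Sum>\<^sub>\<infinity>x. \<bar>f x\<bar> powr r * \<mu> x) \<le> M powr r"
    using summ le by (intro infsum_le_finite_sums) auto
  moreover have "0 \<le> (\<Sum>\<^sub>\<infinity>x. \<bar>f x\<bar> powr r * \<mu> x)"
    by (intro infsum_nonneg) (simp add: \<mu>_nonneg)
  ultimately have "(\<Sum>\<^sub>\<infinity>x. \<bar>f x\<bar> powr r * \<mu> x) powr (1 / r) \<le> (M powr r) powr (1 / r)"
    using 2 by (intro powr_mono2) auto
  also have "\<dots> = M"
    using 2 M by (simp add: powr_powr)
  finally have "lp_norm w p f \<le> M"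
    using 2 by (simp add: lp_norm_def)
  with in_lp nonneg show ?thesis by blast
qed

text \<open>Minkowski's inequality for a series of functions, by passing to the limit in its partial sums.\<close>

lemma lp_le_suminf:
  fixes f :: "nat \<Rightarrow> int ^ 'd \<Rightarrow> real" and c m :: "nat \<Rightarrow> real"
  assumes p: "1 < p" and f: "\<And>n. lp_le p (f n) (m n)"
    and m: "\<And>n. 0 < m n" and c: "\<And>n. 0 \<le> c n" and cm: "summable (\<lambda>n. c n * m n)"
    and cf: "\<And>x. summable (\<lambda>n. c n * f n x)"
  shows "lp_le p (\<lambda>x. \<Sum>n. c n * f n x) (\<Sum>n. c n * m n)"
  using p
proof (cases rule: one_less_ereal_cases)
  case 1
  have "\<bar>\<Sum>n. c n * f n x\<bar> \<le> (\<Sum>n. c n * m n)" for x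
  proof -
    have le: "norm (c n * f n x) \<le> c n * m n" for n
      using f[of n] 1 c[of n] by (auto simp: lp_le_def abs_mult intro: mult_left_mono)
    show ?thesis
      using norm_suminf_le[OF le cm] by simp
  qed
  then show ?thesis using 1 by (simp add: lp_le_def)
next
  case (2 r)
  have "(\<Sum>x\<in>X. \<mu> x * \<bar>\<Sum>n. c n * f n x\<bar> powr r) \<le> (\<Sum>n. c n * m n) powr r"
    if X: "finite X" for X
  proof (rule LIMSEQ_le)
    show "(\<lambda>N. \<Sum>x\<in>X. \<mu> x * \<bar>\<Sum>n<N. c n * f n x\<bar> powr r)
        \<longlonglongrightarrow> (\<Sum>x\<in>X. \<mu> x * \<bar>\<Sum>n. c n * f n x\<bar> powr r)"
      using 2 by (intro tendsto_intros tendsto_powr' summable_LIMSEQ cf) auto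
    show "(\<lambda>N. (\<Sum>n<N. c n * m n) powr r) \<longlonglongrightarrow> (\<Sum>n. c n * m n) powr r"
      using 2 c m by (intro tendsto_powr' tendsto_const summable_LIMSEQ cm)
        (auto intro!: always_eventually sum_nonneg mult_nonneg_nonneg less_imp_le[OF m])
    show "\<exists>N0. \<forall>N\<ge>N0. (\<Sum>x\<in>X. \<mu> x * \<bar>\<Sum>n<N. c n * f n x\<bar> powr r)
        \<le> (\<Sum>n<N. c n * m n) powr r"
      using 2 f m c X by (intro exI[of _ 0] allI impI minkowski_finite_sum) (auto simp: \<mu>_nonneg lp_le_def)
  qed
  then show ?thesis using 2 by (simp add: lp_le_def)
qed

lemma summable_powr_div_Suc:
  assumes "0 < \<theta>"
  shows "summable (\<lambda>n. C * real (Suc n) powr (- \<theta>) / real (Suc n))"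
proof -
  have "summable (\<lambda>n. real n powr (- \<theta> - 1))"
    using assms by (simp add: summable_real_powr_iff)
  then have "summable (\<lambda>n. real (Suc n) powr (- \<theta> - 1))"
    by (subst summable_Suc_iff)
  then have "summable (\<lambda>n. C * real (Suc n) powr (- \<theta> - 1))"
    by (rule summable_mult)
  then show ?thesis
    by (simp add: powr_diff)
qed

text \<open>This is the summability that drives everything: the \<open>\<ell>\<^sup>p\<close> norms of the powers of \<open>P\<close>, divided
  by \<open>n + 1\<close>, are summable, since they decay polynomially.\<close>

lemma P_funpow_lp_le:
  assumes u: "u \<in> Cc" and p: "1 < p"
  obtains m :: "nat \<Rightarrow> real" where "\<And>n. 0 < m n" "\<And>n. lp_le p ((P ^^ Suc n) u) (m n)"
    "summable (\<lambda>n. m n / real (Suc n))"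
proof -
  note result = that
  have *: thesis if C: "0 < C" and \<theta>: "0 < \<theta>"
    and le: "\<And>n. lp_le p ((P ^^ n) u) (C * real (Suc n) powr (- \<theta>))" for C \<theta>
  proof (rule result)
    define m where "m n = C * real (Suc (Suc n)) powr (- \<theta>)" for n
    have m_pos: "0 < m n" for n
      using C by (simp add: m_def)
    have m_le: "m n \<le> C * real (Suc n) powr (- \<theta>)" for n
      unfolding m_def using C \<theta> by (intro mult_left_mono powr_mono2') auto
    show "0 < m n" for n by (rule m_pos)
    show "lp_le p ((P ^^ Suc n) u) (m n)" for n
      unfolding m_def by (rule le)
    show "summable (\<lambda>n. m n / real (Suc n))"
    proof (intro summable_comparison_test[OF _ summable_powr_div_Suc[OF \<theta>, of C]] exI[of _ 0] allI impI)
      fix n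
      show "norm (m n / real (Suc n)) \<le> C * real (Suc n) powr (- \<theta>) / real (Suc n)"
        using m_pos[of n] divide_right_mono[OF m_le[of n], of "real (Suc n)"] by simp
    qed
  qed
  show thesis
    using p
  proof (cases rule: one_less_ereal_cases)
    case 1
    obtain C where C: "0 < C" "\<And>n x. \<bar>(P ^^ n) u x\<bar> \<le> C * real (Suc n) powr (- 1 / 4)"
      by (rule P_funpow_sup_decay[OF u]) blast
    show thesis
      using C 1 by (intro *[of C "1 / 4"]) (auto simp: lp_le_def)
  next
    case (2 r)
    obtain C where C: "0 < C"
      "\<And>n X. finite X \<Longrightarrow> (\<Sum>x\<in>X. \<mu> x * \<bar>(P ^^ n) u x\<bar> powr r)
        \<le> (C * real (Suc n) powr (- (r - 1) / (4 * r))) powr r"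
      by (rule P_funpow_lp_decay[OF u 2(2)]) blast
    have \<theta>: "- ((r - 1) / (4 * r)) = - (r - 1) / (4 * r)"
      by (rule minus_divide_left)
    show thesis
    proof (rule *[of C "(r - 1) / (4 * r)"])
      show "lp_le p ((P ^^ n) u) (C * real (Suc n) powr - ((r - 1) / (4 * r)))" for n
        unfolding \<theta> using C(2) 2 by (simp add: lp_le_def)
    qed (use C 2 in auto)
  qed
qed

section \<open>Power series for the logarithmic and the fractional Laplacian\<close>

lemma P_funpow_summable:
  assumes u: "u \<in> Cc"
  shows "summable (\<lambda>n. \<bar>(P ^^ Suc n) u x\<bar> / real (Suc n))"
proof -
  have one_less_infty: "1 < (\<infinity> :: ereal)" by simp
  obtain m where m: "\<And>n. lp_le \<infinity> ((P ^^ Suc n) u) (m n)" "summable (\<lambda>n. m n / real (Suc n))"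
    using P_funpow_lp_le[OF u, of \<infinity>] by (metis one_less_infty)
  show ?thesis
  proof (intro summable_comparison_test[OF _ m(2)] exI[of _ 0] allI impI)
    fix n
    show "norm (\<bar>(P ^^ Suc n) u x\<bar> / real (Suc n)) \<le> m n / real (Suc n)"
      using m(1)[of n] by (simp add: lp_le_def divide_right_mono del: funpow.simps)
  qed
qed

lemma P_funpow_coef_summable:
  assumes u: "u \<in> Cc" and c: "\<And>n. \<bar>c n\<bar> \<le> 1 / real (Suc n)"
  shows "summable (\<lambda>n. norm (c n * (P ^^ Suc n) u x))"
proof (intro summable_comparison_test[OF _ P_funpow_summable[OF u, of x]] exI[of _ 0] allI impI)
  fix n
  show "norm (norm (c n * (P ^^ Suc n) u x)) \<le> \<bar>(P ^^ Suc n) u x\<bar> / real (Suc n)"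
    using mult_right_mono[OF c[of n], of "\<bar>(P ^^ Suc n) u x\<bar>"] by (simp add: abs_mult del: funpow.simps)
qed

lemma heat_integral:
  assumes u: "u \<in> Cc" and s: "0 \<le> s" "s < 1"
  shows "(LBINT t:{0<..}. (heat_semigroup w t u x - exp (- t) * u x) * t powr (- 1 - s))
    = Gamma (1 - s) * (\<Sum>n. coef s n * (P ^^ Suc n) u x)"
proof -
  obtain B where B: "\<And>x. \<bar>u x\<bar> \<le> B"
    using Cc_bounded[OF u] by metis
  have "\<bar>(P ^^ Suc n) u x\<bar> \<le> B" for n
    using B by (rule P_funpow_bounded)
  from Gamma_series_integral[OF s this P_funpow_summable[OF u]]
  show ?thesis
    unfolding heat_semigroup_split[OF B] by (simp only: add_diff_cancel_left')
qed

text \<open>The Taylor series of \<open>log (1 - P)\<close>.\<close>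

lemma log_laplacian_eq:
  assumes u: "u \<in> Cc"
  shows "log_laplacian w u x = - (\<Sum>n. coef 0 n * (P ^^ Suc n) u x)"
proof -
  have "log_laplacian w u x
      = (LBINT t:{0<..}. - ((heat_semigroup w t u x - exp (- t) * u x) * t powr (- 1 - 0)))"
    unfolding log_laplacian_def
    by (intro set_lebesgue_integral_cong) (auto simp: powr_minus field_simps)
  also have "\<dots> = - (LBINT t:{0<..}. (heat_semigroup w t u x - exp (- t) * u x) * t powr (- 1 - 0))"
    unfolding set_lebesgue_integral_def by simp
  also have "\<dots> = - (\<Sum>n. coef 0 n * (P ^^ Suc n) u x)"
    by (subst heat_integral[OF u]) simp_all
  finally show ?thesis .
qed

text \<open>A jump of the fractional walk from \<open>x\<close> to \<open>y\<close> consists of \<open>n + 1\<close> steps of \<open>P\<close> with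
  probability \<open>s * coef s n\<close>. Off the diagonal the jump-free part of the heat kernel vanishes.\<close>

lemma frac_weight_eq:
  assumes s: "0 < s" "s < 1" and xy: "y \<noteq> x"
  shows "frac_weight w s x y = \<mu> x * (s * (\<Sum>n. coef s n * (P ^^ Suc n) (indicator {y}) x))"
proof -
  have "(LBINT t:{0<..}. heat_kernel w t x y * t powr (- 1 - s))
      = (LBINT t:{0<..}. 1 / \<mu> y * ((heat_semigroup w t (indicator {y}) x
          - exp (- t) * indicator {y} x) * t powr (- 1 - s)))"
    using xy by (simp add: heat_kernel_def mult.assoc)
  also have "\<dots> = 1 / \<mu> y * (LBINT t:{0<..}. (heat_semigroup w t (indicator {y}) x
          - exp (- t) * indicator {y} x) * t powr (- 1 - s))"
    by (rule set_integral_mult_right)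
  also have "\<dots> = 1 / \<mu> y * (Gamma (1 - s) * (\<Sum>n. coef s n * (P ^^ Suc n) (indicator {y}) x))"
    using s by (subst heat_integral[OF indicator_Cc]) auto
  finally have *: "(LBINT t:{0<..}. heat_kernel w t x y * t powr (- 1 - s))
      = 1 / \<mu> y * (Gamma (1 - s) * (\<Sum>n. coef s n * (P ^^ Suc n) (indicator {y}) x))" .
  have "0 < Gamma (1 - s)"
    using s by (intro Gamma_real_pos) simp
  then show ?thesis
    unfolding frac_weight_def * by (simp del: funpow.simps)
qed

text \<open>The binomial series of \<open>(1 - P)\<^sup>s\<close>. The sums over the target \<open>y\<close> and the number of steps are
  interchanged; the term \<open>u x\<close> then has total coefficient \<open>s * (\<Sum>n. coef s n) = 1\<close>.\<close>

lemma frac_laplacian_eq: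
  assumes u: "u \<in> Cc" and s: "0 < s" "s < 1"
  shows "frac_laplacian w s u x = u x - s * (\<Sum>n. coef s n * (P ^^ Suc n) u x)"
proof -
  define F where "F = (\<lambda>(n, y). coef s n * (P ^^ Suc n) (indicator {y}) x * (u x - u y))"
  define S where "S = (\<Sum>n. coef s n * (P ^^ Suc n) u x)"
  obtain B where B: "\<And>x. \<bar>u x\<bar> \<le> B"
    using Cc_bounded[OF u] by metis
  have coef0: "0 \<le> coef s n" for n
    using s by (intro coef_nonneg) auto
  have coef1: "\<bar>coef s n\<bar> \<le> 1 / real (Suc n)" for n
    using s coef0[of n] coef_le[of s n] by simp
  have ind_nonneg: "0 \<le> (P ^^ n) (indicator {y}) x" for n y
    by (rule P_funpow_nonneg) simp
  have col: "((\<lambda>y. F (n, y)) has_sum coef s n * (u x - (P ^^ Suc n) u x)) UNIV" for n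
  proof -
    have "(P ^^ Suc n) (\<lambda>y. u x - u y) x = u x - (P ^^ Suc n) u x"
      using P_funpow_diff[of "Suc n" "\<lambda>_. u x" u x] by (simp only: P_funpow_const)
    then show ?thesis
      using has_sum_cmult_right[OF has_sum_transition_probabilities[of "Suc n" x "\<lambda>y. u x - u y"], of "coef s n"]
      by (simp only: F_def prod.case mult.assoc)
  qed
  have S_sums: "(\<lambda>n. coef s n * (P ^^ Suc n) u x) sums S"
    unfolding S_def
    by (intro summable_sums summable_norm_cancel[OF P_funpow_coef_summable[OF u coef1]])
  have tot: "((\<lambda>n. coef s n * (u x - (P ^^ Suc n) u x)) has_sum (u x / s - S)) UNIV"
  proof (rule norm_summable_imp_has_sum)
    show "(\<lambda>n. coef s n * (u x - (P ^^ Suc n) u x)) sums (u x / s - S)"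
      using sums_diff[OF sums_mult2[OF coef_sums[OF s], of "u x"] S_sums]
      by (simp add: right_diff_distrib del: funpow.simps)
    have summ: "summable (\<lambda>n. coef s n * \<bar>u x\<bar> + norm (coef s n * (P ^^ Suc n) u x))"
      using coef_sums[OF s] P_funpow_coef_summable[OF u coef1]
      by (intro summable_add summable_mult2) (auto simp: sums_iff)
    show "summable (\<lambda>n. norm (coef s n * (u x - (P ^^ Suc n) u x)))"
    proof (intro summable_comparison_test[OF _ summ] exI[of _ 0] allI impI)
      fix n
      show "norm (norm (coef s n * (u x - (P ^^ Suc n) u x)))
          \<le> coef s n * \<bar>u x\<bar> + norm (coef s n * (P ^^ Suc n) u x)"
        using norm_triangle_ineq4[of "coef s n * u x" "coef s n * (P ^^ Suc n) u x"] coef0[of n]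
        by (simp add: right_diff_distrib abs_mult del: funpow.simps)
    qed
  qed
  \<comment> \<open>The rows of the majorant sum to multiples of \<open>coef s n\<close>, since \<open>P\<close> fixes constants.\<close>
  have "(\<lambda>z. norm (F z)) summable_on UNIV \<times> UNIV"
  proof (rule summable_on_comparison_test)
    show "(\<lambda>(n, y). 2 * B * (coef s n * ((P ^^ Suc n) (indicator {y}) x * 1))) summable_on UNIV \<times> UNIV"
    proof (rule summable_on_SigmaI)
      show "((\<lambda>y. case (n, y) of (n, y) \<Rightarrow> 2 * B * (coef s n * ((P ^^ Suc n) (indicator {y}) x * 1)))
          has_sum 2 * B * (coef s n * 1)) UNIV" for n
        using has_sum_cmult_right[OF has_sum_cmult_right[OF
            has_sum_transition_probabilities[of "Suc n" x "\<lambda>_. 1"], of "coef s n"], of "2 * B"]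
        unfolding P_funpow_const by (simp only: prod.case)
      have "(coef s has_sum 1 / s) UNIV"
        using coef_sums[OF s] coef0 by (intro norm_summable_imp_has_sum) (auto simp: sums_iff)
      then show "(\<lambda>n. 2 * B * (coef s n * 1)) summable_on UNIV"
        by (intro summable_on_cmult_right) (auto simp: summable_on_def)
      have "0 \<le> B" using B[of 0] by linarith
      then show "0 \<le> (case (n, y) of (n, y) \<Rightarrow> 2 * B * (coef s n * ((P ^^ Suc n) (indicator {y}) x * 1)))" for n y
        using coef0 ind_nonneg by (simp del: funpow.simps)
    qed
    fix z :: "nat \<times> (int ^ 'd)"
    obtain n y where z: "z = (n, y)" by (cases z)
    have "\<bar>u x - u y\<bar> \<le> 2 * B"
      using B[of x] B[of y] by linarith
    then have "coef s n * (P ^^ Suc n) (indicator {y}) x * \<bar>u x - u y\<bar>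
        \<le> coef s n * (P ^^ Suc n) (indicator {y}) x * (2 * B)"
      using coef0 ind_nonneg by (intro mult_left_mono mult_nonneg_nonneg)
    then show "norm (F z) \<le> (case z of (n, y) \<Rightarrow> 2 * B * (coef s n * ((P ^^ Suc n) (indicator {y}) x * 1)))"
      using coef0[of n] ind_nonneg[of "Suc n" y]
      by (simp add: z F_def abs_mult mult_ac del: funpow.simps)
  qed simp
  then have "F summable_on UNIV \<times> UNIV"
    by (rule abs_summable_summable)
  with col tot have "(F has_sum (u x / s - S)) (UNIV \<times> UNIV)"
    by (intro has_sum_SigmaI) auto
  then have "((\<lambda>(y, n). F (n, y)) has_sum (u x / s - S)) (UNIV \<times> UNIV)"
    by (subst (asm) has_sum_swap)
  moreover have "((\<lambda>n. case (y, n) of (y, n) \<Rightarrow> F (n, y)) has_sum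
      (\<Sum>n. coef s n * (P ^^ Suc n) (indicator {y}) x) * (u x - u y)) UNIV" for y
    unfolding F_def prod.case
    by (intro has_sum_cmult_left norm_summable_imp_has_sum P_funpow_coef_summable[OF indicator_Cc coef1]
        summable_sums summable_norm_cancel[OF P_funpow_coef_summable[OF indicator_Cc coef1]])
  ultimately have "((\<lambda>y. (\<Sum>n. coef s n * (P ^^ Suc n) (indicator {y}) x) * (u x - u y))
      has_sum (u x / s - S)) UNIV"
    by (rule has_sum_SigmaD)
  \<comment> \<open>The diagonal term vanishes because of the factor \<open>u x - u y\<close>.\<close>
  then have "((\<lambda>y. (\<Sum>n. coef s n * (P ^^ Suc n) (indicator {y}) x) * (u x - u y))
      has_sum (u x / s - S)) {y. y \<noteq> x}"
    by (rule has_sum_cong_neutral[THEN iffD1, rotated -1]) auto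
  from has_sum_cmult_right[OF this, of "\<mu> x * s"]
  have "((\<lambda>y. frac_weight w s x y * (u x - u y)) has_sum (\<mu> x * s * (u x / s - S))) {y. y \<noteq> x}"
    by (rule has_sum_cong[THEN iffD1, rotated]) (auto simp: frac_weight_eq[OF s] mult.assoc)
  then have "frac_laplacian w s u x = 1 / \<mu> x * (\<mu> x * s * (u x / s - S))"
    unfolding frac_laplacian_def by (simp only: infsumI)
  also have "\<dots> = u x - s * S"
    using s by (simp add: right_diff_distrib)
  finally show ?thesis by (simp only: S_def)
qed

section \<open>Convergence of the difference quotients\<close>

text \<open>Applied to \<open>coef 0\<close>, to \<open>coef s\<close> and to \<open>coef 0 - coef s\<close>: all three lie between 0 and
  \<open>1 / (n + 1)\<close>.\<close>

lemma lp_le_coef_series: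
  assumes p: "1 < p" and u: "u \<in> Cc"
    and m: "\<And>n. 0 < m n" "\<And>n. lp_le p ((P ^^ Suc n) u) (m n)" "summable (\<lambda>n. m n / real (Suc n))"
    and c: "\<And>n. 0 \<le> c n" "\<And>n. c n \<le> 1 / real (Suc n)"
  defines "F \<equiv> \<lambda>x. \<Sum>n. c n * (P ^^ Suc n) u x"
  shows "F \<in> lp_space w p" "0 \<le> lp_norm w p F" "lp_norm w p F \<le> (\<Sum>n. c n * m n)"
proof -
  have cm: "summable (\<lambda>n. c n * m n)"
  proof (intro summable_comparison_test[OF _ m(3)] exI[of _ 0] allI impI)
    fix n
    show "norm (c n * m n) \<le> m n / real (Suc n)"
      using c(1)[of n] mult_right_mono[OF c(2)[of n], of "m n"] m(1)[of n] by (simp add: abs_mult)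
  qed
  have "lp_le p F (\<Sum>n. c n * m n)"
    unfolding F_def
  proof (rule lp_le_suminf[OF p m(2) m(1) c(1) cm])
    show "summable (\<lambda>n. c n * (P ^^ Suc n) u x)" for x
      using c by (intro summable_norm_cancel[OF P_funpow_coef_summable[OF u]]) simp
  qed
  moreover have "0 \<le> (\<Sum>n. c n * m n)"
    using c m by (intro suminf_nonneg[OF cm] mult_nonneg_nonneg) (auto simp: less_imp_le)
  ultimately show "F \<in> lp_space w p" "0 \<le> lp_norm w p F" "lp_norm w p F \<le> (\<Sum>n. c n * m n)"
    using lp_le_imp_lp_space[OF p] by blast+
qed

lemma lp_uminus: "(\<lambda>x. - f x) \<in> lp_space w p \<longleftrightarrow> f \<in> lp_space w p"
  by (auto simp: lp_space_def bounded_iff)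

lemma log_laplacian_lp_limit:
  assumes p: "1 < p" and u: "u \<in> Cc"
  shows "log_laplacian w u \<in> lp_space w p"
    and "lp_tendsto w p (\<lambda>s x. (frac_laplacian w s u x - u x) / s) (log_laplacian w u) (at_right 0)"
proof -
  obtain m where m: "\<And>n. 0 < m n" "\<And>n. lp_le p ((P ^^ Suc n) u) (m n)"
    "summable (\<lambda>n. m n / real (Suc n))"
    by (rule P_funpow_lp_le[OF u p]) blast
  note series = lp_le_coef_series[OF p u m]
  define T where "T s x = (\<Sum>n. coef s n * (P ^^ Suc n) u x)" for s x
  have coef_bounds: "0 \<le> coef s n" "coef s n \<le> coef 0 n" "coef s n \<le> 1 / real (Suc n)"
    if "0 \<le> s" "s < 1" for s n
    using that coef_nonneg coef_le by (auto simp: coef_zero)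
  have T_lp: "T s \<in> lp_space w p" if "0 \<le> s" "s < 1" for s
    unfolding T_def[abs_def] using that by (intro series coef_bounds)
  have log_eq: "log_laplacian w u = (\<lambda>x. - T 0 x)"
    by (rule ext) (simp only: log_laplacian_eq[OF u] T_def)
  show log_lp: "log_laplacian w u \<in> lp_space w p"
    unfolding log_eq lp_uminus by (rule T_lp) auto
  have frac_eq: "(\<lambda>x. (frac_laplacian w s u x - u x) / s) = (\<lambda>x. - T s x)" if "0 < s" "s < 1" for s
    using that by (simp add: frac_laplacian_eq[OF u that] T_def del: funpow.simps)
  have diff: "(\<lambda>x. - T s x - - T 0 x) = (\<lambda>x. \<Sum>n. (coef 0 n - coef s n) * (P ^^ Suc n) u x)"
    if "0 \<le> s" "s < 1" for s
  proof
    fix x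
    have "summable (\<lambda>n. coef s n * (P ^^ Suc n) u x)" if "0 \<le> s" "s < 1" for s
      using coef_bounds[OF that] by (intro summable_norm_cancel[OF P_funpow_coef_summable[OF u]]) simp
    from suminf_diff[OF this this, of 0 s] that
    show "- T s x - - T 0 x = (\<Sum>n. (coef 0 n - coef s n) * (P ^^ Suc n) u x)"
      by (simp add: T_def left_diff_distrib del: funpow.simps)
  qed
  \<comment> \<open>The \<open>\<ell>\<^sup>p\<close> norms of the differences are squeezed by a numerical series, which Tannery's theorem
    sends to 0.\<close>
  have ev: "\<forall>\<^sub>F s in at_right 0. 0 < s \<and> s < (1 :: real)"
    by (auto intro: eventually_at_rightI[of 0 1])
  have "((\<lambda>s. \<Sum>n. (coef 0 n - coef s n) * m n) \<longlongrightarrow> (\<Sum>n. 0)) (at_right 0)"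
  proof (rule tannerys_theorem[THEN conjunct2, THEN conjunct2])
    show "((\<lambda>s. (coef 0 n - coef s n) * m n) \<longlongrightarrow> 0) (at_right 0)" for n
      using tendsto_mult_right[OF tendsto_diff[OF tendsto_const coef_tendsto[of n]], of "coef 0 n" "m n"]
      by simp
    show "\<forall>\<^sub>F (n, s) in at_top \<times>\<^sub>F at_right 0. norm ((coef 0 n - coef s n) * m n) \<le> m n / real (Suc n)"
      unfolding eventually_prod_filter
    proof (rule exI[of _ "\<lambda>_. True"], rule exI[of _ "\<lambda>s. 0 < s \<and> s < 1"], intro conjI ev allI impI)
      fix n and s :: real
      assume "0 < s \<and> s < 1"
      then have "0 \<le> coef 0 n - coef s n" "coef 0 n - coef s n \<le> 1 / real (Suc n)"
        using coef_bounds[of s n] by (auto simp: coef_zero)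
      then show "case (n, s) of (n, s) \<Rightarrow> norm ((coef 0 n - coef s n) * m n) \<le> m n / real (Suc n)"
        using m(1)[of n] mult_right_mono[of "coef 0 n - coef s n" "1 / real (Suc n)" "m n"]
        by (simp add: abs_mult)
    qed simp
  qed (use m(3) in auto)
  then have lim: "((\<lambda>s. \<Sum>n. (coef 0 n - coef s n) * m n) \<longlongrightarrow> 0) (at_right 0)"
    by simp
  show "lp_tendsto w p (\<lambda>s x. (frac_laplacian w s u x - u x) / s) (log_laplacian w u) (at_right 0)"
    unfolding lp_tendsto_def
  proof (intro conjI log_lp)
    show "\<forall>\<^sub>F s in at_right 0. (\<lambda>x. (frac_laplacian w s u x - u x) / s) \<in> lp_space w p"
      using ev by eventually_elim (simp add: frac_eq lp_uminus T_lp)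
    have norm: "0 \<le> lp_norm w p (\<lambda>x. (frac_laplacian w s u x - u x) / s - log_laplacian w u x)"
      "lp_norm w p (\<lambda>x. (frac_laplacian w s u x - u x) / s - log_laplacian w u x)
        \<le> (\<Sum>n. (coef 0 n - coef s n) * m n)" if s: "0 < s" "s < 1" for s
    proof -
      have "(\<lambda>x. (frac_laplacian w s u x - u x) / s - log_laplacian w u x)
          = (\<lambda>x. \<Sum>n. (coef 0 n - coef s n) * (P ^^ Suc n) u x)"
        using s diff[of s] fun_cong[OF frac_eq[OF s]] by (simp add: log_eq)
      then show "0 \<le> lp_norm w p (\<lambda>x. (frac_laplacian w s u x - u x) / s - log_laplacian w u x)"
        "lp_norm w p (\<lambda>x. (frac_laplacian w s u x - u x) / s - log_laplacian w u x)
          \<le> (\<Sum>n. (coef 0 n - coef s n) * m n)"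
        using series(2,3)[of "\<lambda>n. coef 0 n - coef s n"] coef_bounds[of s] s
        by (simp_all add: coef_zero del: funpow.simps)
    qed
    show "((\<lambda>s. lp_norm w p (\<lambda>x. (frac_laplacian w s u x - u x) / s - log_laplacian w u x))
        \<longlongrightarrow> 0) (at_right 0)"
      by (rule tendsto_sandwich[OF _ _ tendsto_const lim]) (use ev norm in \<open>auto elim: eventually_mono\<close>)
  qed
qed

end

theorem theorem1p8:
  fixes w :: "int ^ 'd \<Rightarrow> int ^ 'd \<Rightarrow> real"
    and u :: "int ^ 'd \<Rightarrow> real"
    and p :: ereal
  assumes "lattice_weight w"
    and "0 < vmeas_min w" and "vmeas_min w \<le> vmeas_max w" and "vmeas_max w < \<infinity>"
    and "0 < weight_inf w"
    and "u \<in> Cc"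
    and "1 < p" and "p \<le> \<infinity>"
  shows "log_laplacian w u \<in> lp_space w p \<and>
    lp_tendsto w p (\<lambda>s x. (frac_laplacian w s u x - u x) / s) (log_laplacian w u)
      (at_right (0 :: real))"
proof -
  \<comment> \<open>The infimum is an extended real, so a real lower bound is chosen strictly below it.\<close>
  obtain w0 where w0: "0 < ereal w0" "ereal w0 < weight_inf w"
    using ereal_dense2[OF \<open>0 < weight_inf w\<close>] by blast
  have "w0 \<le> w x y" if "x \<sim>\<^sub>\<int> y" for x y
  proof -
    have "weight_inf w \<le> ereal (w x y)"
      unfolding weight_inf_def using that by (intro INF_lower2[of "(x, y)"]) auto
    then have "ereal w0 < ereal (w x y)"
      using w0(2) by (rule less_le_trans[rotated])
    then show ?thesis by simp
  qed
  then interpret elliptic_lattice w w0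
    using \<open>lattice_weight w\<close> w0(1) by unfold_locales auto
  show ?thesis
    using log_laplacian_lp_limit[OF \<open>1 < p\<close> \<open>u \<in> Cc\<close>] by blast
qed

end
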